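(* There are universal constants $0<c\le C<\infty$ such that for every $d\in\mathbb N\cup\{\infty\}$ with $d\ge1$ and every $p\in[2,\infty)$, $$c\,\frac p{\log p}\le\mathfrak X_p^{(d)}\le C\,\frac p{\log p};$$ that is, $\mathfrak X_p^{(d)}\asymp p/\log p$ with universal comparison constants independent of $d$.
   Context: $[n]=\{1,\dots,n\}$, $\Omega_n=\{-1,1\}^n$ with the uniform probability measure, $\mathbb E$ the average over $\Omega_n$, $\|h\|_p=(\mathbb E|h|^p)^{1/p}$. For $A\subseteq[n]$, $W_A(\varepsilon)=\prod_{j\in A}\varepsilon_j$; $h$ is a Walsh polynomial of degree at most $d$ if $\mathbb E[hW_A]=0$ whenever $|A|>d$ (no restriction when $d=\infty$). For $S\subseteq[n]$, $P_Sh(\varepsilon)$ is the average of $h(\eta)$ over all $\eta\in\Omega_n$ with $\eta_j=\varepsilon_j$ for all $j\in S$. If $\varepsilon^{(j)}$ is $\varepsilon$ with the sign of its $j$th coordinate changed, $\partial_jh(\varepsilon)=h(\varepsilon)-h(\varepsilon^{(j)})$. Logarithms are natural. $\mathfrak X_p^{(d)}$ is the least $K\in[0,\infty]$ such that, for every $n\in\mathbb N$, $k\in[n]$, $\mathbb K\in\{\mathbb R,\mathbb C\}$, and every Walsh polynomial $h:\Omega_n\to\mathbb K$ of degree at most $d$ with $\mathbb E h=0$, $$\left(\binom nk^{-1}\sum_{\substack{S\subseteq[n]\\|S|=k}}\|P_Sh\|_p^p\right)^{1/p}\le K\left[\frac kn\sum_{j=1}^n\|\partial_jh\|_p^p+\left(\frac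 kn\right)^{p/2}\|h\|_p^p\right]^{1/p}.$$ *)

theory Defs
  imports "HOL-Analysis.Analysis"
begin

text \<open>Points of the cube are the extensional functions, so that functions on the cube are
  total functions of which only the values on \<^term>\<open>cube n\<close> are ever inspected.\<close>

definition cube :: "nat \<Rightarrow> (nat \<Rightarrow> real) set" where
  "cube n = {1..n} \<rightarrow>\<^sub>E {-1, 1}"

definition avg :: "'b set \<Rightarrow> ('b \<Rightarrow> 'a::real_vector) \<Rightarrow> 'a" where
  "avg X h = (\<Sum>x\<in>X. h x) /\<^sub>R real (card X)"

abbreviation expec :: "nat \<Rightarrow> ((nat \<Rightarrow> real) \<Rightarrow> 'a::real_vector) \<Rightarrow> 'a" where
  "expec n h \<equiv> avg (cube n) h"

definition Lnorm :: "nat \<Rightarrow> real \<Rightarrow> ((nat \<Rightarrow> real) \<Rightarrow> 'a::real_normed_vector) \<Rightarrow> real" where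
  "Lnorm n p h = (expec n (\<lambda>\<epsilon>. norm (h \<epsilon>) powr p)) powr (1 / p)"

definition walsh :: "nat set \<Rightarrow> (nat \<Rightarrow> real) \<Rightarrow> real" where
  "walsh A \<epsilon> = (\<Prod>j\<in>A. \<epsilon> j)"

definition walsh_poly :: "nat \<Rightarrow> enat \<Rightarrow> ((nat \<Rightarrow> real) \<Rightarrow> 'a::real_normed_field) \<Rightarrow> bool" where
  "walsh_poly n d h \<longleftrightarrow>
     (\<forall>A \<subseteq> {1..n}. d < enat (card A) \<longrightarrow> expec n (\<lambda>\<epsilon>. h \<epsilon> * of_real (walsh A \<epsilon>)) = 0)"

definition proj :: "nat \<Rightarrow> nat set \<Rightarrow> ((nat \<Rightarrow> real) \<Rightarrow> 'a::real_vector) \<Rightarrow> (nat \<Rightarrow> real) \<Rightarrow> 'a" where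
  "proj n S h \<epsilon> = avg {\<eta> \<in> cube n. \<forall>j\<in>S. \<eta> j = \<epsilon> j} h"

definition flip_diff :: "nat \<Rightarrow> ((nat \<Rightarrow> real) \<Rightarrow> 'a::real_vector) \<Rightarrow> (nat \<Rightarrow> real) \<Rightarrow> 'a" where
  "flip_diff j h \<epsilon> = h \<epsilon> - h (\<epsilon>(j := - \<epsilon> j))"

definition sampled_norm ::
    "nat \<Rightarrow> nat \<Rightarrow> real \<Rightarrow> ((nat \<Rightarrow> real) \<Rightarrow> 'a::real_normed_field) \<Rightarrow> real" where
  "sampled_norm n k p h =
     (1 / real (n choose k) *
        (\<Sum>S \<in> {S. S \<subseteq> {1..n} \<and> card S = k}. Lnorm n p (proj n S h) powr p)) powr (1 / p)"

definition influence_bound ::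
    "nat \<Rightarrow> nat \<Rightarrow> real \<Rightarrow> ((nat \<Rightarrow> real) \<Rightarrow> 'a::real_normed_field) \<Rightarrow> real" where
  "influence_bound n k p h =
     (real k / real n * (\<Sum>j = 1..n. Lnorm n p (flip_diff j h) powr p) +
      (real k / real n) powr (p / 2) * Lnorm n p h powr p) powr (1 / p)"

text \<open>The type argument \<^typ>\<open>'a itself\<close> is the scalar field of the functions \<open>h\<close>.\<close>

definition admissible :: "'a::real_normed_field itself \<Rightarrow> enat \<Rightarrow> real \<Rightarrow> ennreal \<Rightarrow> bool" where
  "admissible _ d p K \<longleftrightarrow>
     (\<forall>n. \<forall>k\<in>{1..n}. \<forall>h :: (nat \<Rightarrow> real) \<Rightarrow> 'a.
        walsh_poly n d h \<and> expec n h = 0 \<longrightarrow>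
        ennreal (sampled_norm n k p h) \<le> K * ennreal (influence_bound n k p h))"

definition best_const :: "enat \<Rightarrow> real \<Rightarrow> ennreal" where
  "best_const d p = Inf {K. admissible TYPE(real) d p K \<and> admissible TYPE(complex) d p K}"

text \<open>The infimum is attained, so \<^const>\<open>best_const\<close> is indeed the least admissible constant.\<close>

lemma influence_bound_zero:
  fixes h :: "(nat \<Rightarrow> real) \<Rightarrow> 'a::real_normed_field"
  assumes "1 \<le> k" "k \<le> n" "0 < p" "influence_bound n k p h = 0"
  shows "sampled_norm n k p h = 0"
proof -
  have fin: "finite (cube n)" by (simp add: cube_def finite_PiE)
  have ne: "cube n \<noteq> {}" by (simp add: cube_def PiE_eq_empty_iff)
  have "Lnorm n p h powr p = 0"
  proof -
    have a: "0 \<le> real k / real n * (\<Sum>j = 1..n. Lnorm n p (flip_diff j h) powr p)"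
      by (intro mult_nonneg_nonneg sum_nonneg) auto
    have b: "0 \<le> (real k / real n) powr (p / 2) * Lnorm n p h powr p" by simp
    have "(real k / real n) powr (p / 2) * Lnorm n p h powr p = 0"
      using assms(4) a b unfolding influence_bound_def powr_eq_0_iff by linarith
    then show ?thesis using assms by simp
  qed
  then have "(\<Sum>\<epsilon>\<in>cube n. norm (h \<epsilon>) powr p) = 0"
    using fin ne by (auto simp: Lnorm_def avg_def)
  then have h0: "h \<epsilon> = 0" if "\<epsilon> \<in> cube n" for \<epsilon>
    using that fin by (subst (asm) sum_nonneg_eq_0_iff) auto
  have "proj n S h \<epsilon> = 0" for S \<epsilon>
    unfolding proj_def avg_def by (simp add: h0)
  then show ?thesis by (simp add: sampled_norm_def Lnorm_def avg_def)
qed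

lemma admissible_Inf:
  assumes "0 < p" "\<And>K. K \<in> X \<Longrightarrow> admissible TYPE('a::real_normed_field) d p K"
  shows "admissible TYPE('a) d p (Inf X)"
  unfolding admissible_def
proof (intro allI ballI impI)
  fix n k and h :: "(nat \<Rightarrow> real) \<Rightarrow> 'a"
  assume k: "k \<in> {1..n}" and h: "walsh_poly n d h \<and> expec n h = 0"
  let ?a = "ennreal (sampled_norm n k p h)" and ?b = "ennreal (influence_bound n k p h)"
  show "?a \<le> Inf X * ?b"
  proof (cases "influence_bound n k p h = 0")
    case True
    then show ?thesis using influence_bound_zero[of k n p h] k assms by simp
  next
    case False
    then have b: "0 < influence_bound n k p h" by (simp add: influence_bound_def)
    have le: "?a / ?b \<le> K" if "K \<in> X" for K
    proof -
      have "?a \<le> K * ?b" using assms(2)[OF that] k h unfolding admissible_def by blast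
      then show ?thesis using b by (simp add: divide_le_posI_ennreal mult.commute)
    qed
    have "?a = ?a / ?b * ?b"
      using b by (simp add: ennreal_divide_times ennreal_mult_divide_eq)
    also have "\<dots> \<le> Inf X * ?b" by (intro mult_right_mono Inf_greatest le) auto
    finally show ?thesis .
  qed
qed

lemma best_const_least:
  assumes "0 < p"
  shows "admissible TYPE(real) d p (best_const d p)" "admissible TYPE(complex) d p (best_const d p)"
    "\<And>K. admissible TYPE(real) d p K \<Longrightarrow> admissible TYPE(complex) d p K \<Longrightarrow> best_const d p \<le> K"
  unfolding best_const_def
  by (auto intro!: admissible_Inf assms Inf_lower)

end

theory Submission
  imports Defs
begin

text \<open>The upper bound is a Rosenthal inequality for the martingale that reveals the coordinates of
  \<open>\<epsilon>\<close> one at a time in a uniformly random order; after \<open>k\<close> steps it averages the moments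
  of \<open>P\<^sub>S h\<close> over all sets \<open>S\<close> of size \<open>k\<close>. Revealing the coordinate \<open>j\<close> after
  the set \<open>T\<close> changes \<open>P\<^sub>T h\<close> by \<open>\<epsilon> j * w\<close>, where \<open>w\<close> is a first-order Walsh coefficient
  of \<open>h\<close> on a subcube (\<open>proj_insert\<close>). Two facts control the increments. Individually, \<open>w\<close> is
  bounded by a conditional average of the \<open>j\<close>-th discrete derivative
  (\<open>norm_cond_coeff_powr_le\<close>), and a given \<open>j\<close> is revealed within the first \<open>k\<close> steps with
  probability \<open>k / n\<close>. Collectively, Bessel's inequality bounds the sum of the squares of the
  coefficients over all free \<open>j\<close> by \<open>P\<^sub>T (h\<^sup>2)\<close> (\<open>cond_coeff_bessel\<close>), so the conditional
  variance of a step is at most \<open>P\<^sub>T (h\<^sup>2) / (n - i)\<close>.\<close>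

text \<open>These enter through the pointwise inequality \<open>symmetrized_powr_le\<close>, which bounds a
  symmetrised \<open>p\<close>-th power by \<open>|x|\<^sup>p + p powr (5/2) * |x| powr (p - 2) * |w|\<^sup>2\<close> plus
  \<open>|w|\<^sup>p\<close> with a constant of order \<open>(p / ln p) powr p\<close>. The bounds for the conditional
  variances are themselves conditional averages, with the same \<open>p / 2\<close>-th moment bound at every
  step. Hence the averages over sets of size \<open>i\<close> satisfy a linear recursion in \<open>i\<close>: it has
  growth factor \<open>1 + p / k\<close> (\<open>sampled_moment_Suc_le\<close>) and solving it yields a constant of order
  \<open>p powr (3/4)\<close> for the variance term and \<open>p / ln p\<close> for the increments.\<close>

text \<open>For the lower bound, the test function is a sum of \<open>q\<close> signs with \<open>q\<close> close to
  \<open>p / ln p\<close>, in dimension \<open>n = q ^ 3\<close> with \<open>k = q\<close>. The right-hand side stays bounded by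
  \<open>4\<close> times the constant, while the event that the sample is exactly the
  support of the sum and that all signs agree, where the sum equals \<open>q\<close>, has probability at
  least \<open>exp (- 7 * p)\<close>. This function has degree one, so the same bound is available for every
  degree \<open>d\<close>.\<close>

section \<open>Power inequalities\<close>

lemma power2_powr_half: "0 \<le> t \<Longrightarrow> (t\<^sup>2) powr (p / 2) = t powr p" for t p :: real
  by (cases "t = 0") (simp_all add: powr_powr flip: powr_numeral)

lemma powr_above_tangent:
  fixes x m q :: real
  assumes "0 \<le> x" "0 < m" "1 \<le> q"
  shows "m powr q + q * m powr (q - 1) * (x - m) \<le> x powr q"
proof (cases "x = 0")
  case True
  have "m powr q = m powr (q - 1) * m"
    using assms by (simp add: powr_diff)
  then have "m powr q + q * m powr (q - 1) * (x - m) = m powr (q - 1) * m * (1 - q)"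
    unfolding True by algebra
  also have "\<dots> \<le> 0"
    using assms by (intro mult_nonneg_nonpos) auto
  finally show ?thesis using True by simp
next
  case False
  let ?y = "x / m"
  have "(?y powr q) powr (1 / q) * 1 powr (1 - 1 / q) \<le> 1 / q * (?y powr q) + (1 - 1 / q) * 1"
    using assms False by (intro Youngs_inequality_0) auto
  then have "?y \<le> 1 / q * (?y powr q) + (1 - 1 / q)"
    using assms by (simp add: powr_powr)
  then have "q * ?y \<le> q * (1 / q * (?y powr q) + (1 - 1 / q))"
    using assms by (intro mult_left_mono) auto
  also have "\<dots> = ?y powr q + q - 1"
    using assms by (simp add: field_simps)
  finally have "m powr q * (q * ?y) \<le> m powr q * (?y powr q + q - 1)"
    by (intro mult_left_mono) auto
  moreover have "m powr q * ?y powr q = x powr q"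
    using assms by (simp add: powr_divide)
  moreover have "m powr q = m powr (q - 1) * m"
    using assms by (simp add: powr_diff)
  ultimately show ?thesis
    using assms by (simp add: algebra_simps)
qed

text \<open>The term of order \<open>z\<close> cancels in \<open>cosh z\<close>, so the deviation from \<open>1\<close> is quadratic in
  \<open>z\<close>. It comes with the factor \<open>exp (y + z)\<close>, which in the application is at most \<open>sqrt p\<close>.\<close>

lemma exp_mult_cosh_le:
  fixes y z :: real
  assumes "0 \<le> y" "0 \<le> z"
  shows "exp y * ((exp z + exp (- z)) / 2) \<le> 1 + (y + z\<^sup>2 / 2) * exp (y + z)"
proof -
  have exp_minus_one_le: "exp t - 1 \<le> t * exp t" for t :: real
  proof -
    have "(1 - t) * exp t \<le> exp (- t) * exp t"
      using exp_ge_add_one_self[of "- t"] by (intro mult_right_mono) auto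
    then show ?thesis by (simp add: algebra_simps flip: exp_add)
  qed
  have "(exp z + exp (- z)) / 2 = 1 + (exp z - 1)\<^sup>2 * exp (- z) / 2"
    by (simp add: power2_eq_square algebra_simps flip: exp_add) (simp add: exp_minus field_simps)
  also have "(exp z - 1)\<^sup>2 * exp (- z) \<le> (z * exp z)\<^sup>2 * exp (- z)"
    using exp_minus_one_le[of z] assms by (intro mult_right_mono power_mono) auto
  also have "\<dots> = z\<^sup>2 * exp z"
    by (simp add: power_mult_distrib power2_eq_square mult.assoc flip: exp_add)
  finally have "(exp z + exp (- z)) / 2 \<le> 1 + z\<^sup>2 * exp z / 2" by simp
  then have "exp y * ((exp z + exp (- z)) / 2) \<le> exp y * (1 + z\<^sup>2 * exp z / 2)"
    by (intro mult_left_mono) auto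
  also have "\<dots> = exp y + z\<^sup>2 / 2 * exp (y + z)"
    by (simp add: algebra_simps exp_add)
  also have "exp y \<le> 1 + y * exp y"
    using exp_minus_one_le[of y] by simp
  also have "y * exp y \<le> y * exp (y + z)"
    using assms by (intro mult_left_mono) auto
  finally show ?thesis by (simp add: algebra_simps)
qed

text \<open>Writing \<open>(norm (x \<plusminus> v))\<^sup>2 = (norm x)\<^sup>2 * (1 + u\<^sup>2 \<plusminus> 2 * s)\<close> and bounding \<open>1 + a\<close> by
  \<open>exp a\<close> turns the symmetrised \<open>p\<close>-th power into a hyperbolic cosine, which is largest when
  \<open>v\<close> is parallel to \<open>x\<close>. The argument works in any inner product space and so serves
  real and complex functions alike.\<close>

lemma norm_pm_powr_le:
  fixes x v :: "'a::real_inner" and p u :: real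
  assumes "2 \<le> p" and u: "0 \<le> u" "norm v = u * norm x" and x: "x \<noteq> 0"
  shows "(norm (x + v) powr p + norm (x - v) powr p) / 2
    \<le> norm x powr p * (exp (p * u\<^sup>2 / 2) * ((exp (p * u) + exp (- (p * u))) / 2))"
proof -
  \<comment> \<open>The component of \<open>v\<close> along \<open>x\<close>, relative to \<open>x\<close>.\<close>
  define s where "s = x \<bullet> v / (norm x)\<^sup>2"
  have s: "\<bar>s\<bar> \<le> u"
  proof -
    have "\<bar>x \<bullet> v\<bar> \<le> u * (norm x)\<^sup>2"
      using Cauchy_Schwarz_ineq2[of x v] u by (simp add: power2_eq_square mult_ac)
    then show ?thesis using x by (simp add: s_def divide_simps)
  qed
  have bound: "norm (x + c *\<^sub>R v) powr p \<le> norm x powr p * exp (p * u\<^sup>2 / 2 + p * c * s)"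
    if "c = 1 \<or> c = -1" for c :: real
  proof -
    have "(norm (x + c *\<^sub>R v))\<^sup>2 = (norm x)\<^sup>2 + 2 * c * (x \<bullet> v) + (norm v)\<^sup>2"
      using that by (auto simp: power2_norm_eq_inner inner_simps inner_commute)
    also have "\<dots> = (norm x)\<^sup>2 * (1 + (u\<^sup>2 + 2 * c * s))"
      using x u by (simp add: s_def field_simps power_mult_distrib)
    also have "\<dots> \<le> (norm x)\<^sup>2 * exp (u\<^sup>2 + 2 * c * s)"
      by (intro mult_left_mono exp_ge_add_one_self) auto
    finally have sq: "(norm (x + c *\<^sub>R v))\<^sup>2 \<le> (norm x)\<^sup>2 * exp (u\<^sup>2 + 2 * c * s)" .
    have "norm (x + c *\<^sub>R v) powr p = ((norm (x + c *\<^sub>R v))\<^sup>2) powr (p / 2)"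
      by (simp only: power2_powr_half norm_ge_zero)
    also have "\<dots> \<le> ((norm x)\<^sup>2 * exp (u\<^sup>2 + 2 * c * s)) powr (p / 2)"
      using assms by (intro powr_mono2 sq) auto
    also have "\<dots> = norm x powr p * exp (u\<^sup>2 + 2 * c * s) powr (p / 2)"
      by (simp add: powr_mult power2_powr_half)
    also have "exp (u\<^sup>2 + 2 * c * s) powr (p / 2) = exp (p * u\<^sup>2 / 2 + p * c * s)"
      by (simp add: powr_def algebra_simps)
    finally show ?thesis .
  qed
  have "cosh (p * s) \<le> cosh (p * u)"
  proof -
    have "cosh (p * s) = cosh (p * \<bar>s\<bar>)" by (cases "0 \<le> s") simp_all
    also have "\<dots> \<le> cosh (p * u)"
      using assms s by (subst cosh_real_nonneg_le_iff) (auto intro: mult_left_mono)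
    finally show ?thesis .
  qed
  then have c: "exp (p * s) + exp (- (p * s)) \<le> exp (p * u) + exp (- (p * u))"
    by (simp add: cosh_def)
  have "norm (x + v) powr p + norm (x - v) powr p
      \<le> norm x powr p * (exp (p * u\<^sup>2 / 2) * (exp (p * s) + exp (- (p * s))))"
    using add_mono[OF bound[of 1] bound[of "-1"]] by (simp add: mult_exp_exp distrib_left)
  also have "\<dots> \<le> norm x powr p * (exp (p * u\<^sup>2 / 2) * (exp (p * u) + exp (- (p * u))))"
    using c by (intro mult_left_mono) auto
  finally show ?thesis by simp
qed

text \<open>The one-step inequality behind the rate \<open>p / ln p\<close>. An increment with
  \<open>norm v \<ge> (ln p / (4 * p)) * norm x\<close> dominates \<open>x\<close> at the cost of a factor of order
  \<open>p / ln p\<close>, and is paid for by its own \<open>p\<close>-th power. For a smaller increment the second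
  order expansion is valid with constant \<open>p\<^sup>2 * exp (ln p / 2) = p powr (5/2)\<close>: the threshold
  is chosen so that the exponential error is only a small power of \<open>p\<close>. Any exponent below
  \<open>3\<close> would do here, since the square root of this constant divided by \<open>p\<close> must not
  exceed the order of \<open>p / ln p\<close>.\<close>

lemma symmetrized_powr_le:
  fixes x v :: "'a::real_inner" and p :: real
  assumes p: "2 \<le> p"
  shows "(norm (x + v) powr p + norm (x - v) powr p) / 2
    \<le> norm x powr p + p powr (5/2) * norm x powr (p - 2) * (norm v)\<^sup>2
      + (1 + 4 * p / ln p) powr p * norm v powr p"
proof (cases "ln p * norm x \<le> 4 * p * norm v")
  case True
  have lnp: "0 < ln p" using p by simp
  have "norm x \<le> 4 * p / ln p * norm v"
    using True lnp by (simp add: field_simps)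
  then have le: "norm x + norm v \<le> (1 + 4 * p / ln p) * norm v"
    by (simp add: algebra_simps)
  define t where "t = ((1 + 4 * p / ln p) * norm v) powr p"
  have "norm (x + v) powr p \<le> t"
    unfolding t_def using p le norm_triangle_ineq[of x v] by (intro powr_mono2) auto
  moreover have "norm (x - v) powr p \<le> t"
    unfolding t_def using p le norm_triangle_ineq4[of x v] by (intro powr_mono2) auto
  ultimately have "(norm (x + v) powr p + norm (x - v) powr p) / 2 \<le> t" by simp
  also have "t = (1 + 4 * p / ln p) powr p * norm v powr p"
    using p lnp by (simp add: t_def powr_mult)
  also have "\<dots> \<le> norm x powr p + p powr (5/2) * norm x powr (p - 2) * (norm v)\<^sup>2 + \<dots>"
    by simp
  finally show ?thesis .
next
  case False
  have lnp: "0 < ln p" using p by simp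
  from False have x: "x \<noteq> 0" using p by auto
  define u where "u = norm v / norm x"
  have u: "0 \<le> u" "norm v = u * norm x" using x by (auto simp: u_def)
  have pu: "4 * (p * u) \<le> ln p"
    using False x by (simp add: u_def field_simps)
  have u1: "u \<le> 1"
  proof -
    have "4 * (p * u) \<le> p" using pu p ln_le_minus_one[of p] by linarith
    then have "p * (4 * u) \<le> p * 1" by linarith
    then have "4 * u \<le> 1" using p by (subst (asm) mult_le_cancel_left_pos) auto
    then show ?thesis using u by simp
  qed
  have y: "p * u\<^sup>2 / 2 \<le> p * u"
  proof -
    have "p * (u * u) \<le> p * (u * 1)" using u u1 p by (intro mult_left_mono) auto
    then show ?thesis using p u by (simp add: power2_eq_square)
  qed
  have "exp (p * u\<^sup>2 / 2) * ((exp (p * u) + exp (- (p * u))) / 2)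
      \<le> 1 + (p * u\<^sup>2 / 2 + (p * u)\<^sup>2 / 2) * exp (p * u\<^sup>2 / 2 + p * u)"
    using u p by (intro exp_mult_cosh_le) auto
  also have "\<dots> \<le> 1 + p\<^sup>2 * u\<^sup>2 * exp (ln p / 2)"
  proof -
    have "p * u\<^sup>2 \<le> p\<^sup>2 * u\<^sup>2"
      using p by (intro mult_right_mono) (auto simp: power2_eq_square)
    then have "p * u\<^sup>2 / 2 + (p * u)\<^sup>2 / 2 \<le> p\<^sup>2 * u\<^sup>2" by (simp add: power_mult_distrib)
    moreover have "exp (p * u\<^sup>2 / 2 + p * u) \<le> exp (ln p / 2)" using y pu by simp
    ultimately have "(p * u\<^sup>2 / 2 + (p * u)\<^sup>2 / 2) * exp (p * u\<^sup>2 / 2 + p * u) \<le> p\<^sup>2 * u\<^sup>2 * exp (ln p / 2)"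
      using p by (intro mult_mono) auto
    then show ?thesis by simp
  qed
  also have "p\<^sup>2 * u\<^sup>2 * exp (ln p / 2) = p powr (5/2) * u\<^sup>2"
  proof -
    have "p powr (5/2) = p powr 2 * p powr (1/2)" by (simp flip: powr_add)
    moreover have "p powr (1/2) = exp (ln p / 2)" using p by (simp add: powr_def)
    ultimately show ?thesis using p by simp
  qed
  finally have E: "exp (p * u\<^sup>2 / 2) * ((exp (p * u) + exp (- (p * u))) / 2) \<le> 1 + p powr (5/2) * u\<^sup>2" .
  have "(norm (x + v) powr p + norm (x - v) powr p) / 2
      \<le> norm x powr p * (exp (p * u\<^sup>2 / 2) * ((exp (p * u) + exp (- (p * u))) / 2))"
    using p u x by (rule norm_pm_powr_le)
  also have "\<dots> \<le> norm x powr p * (1 + p powr (5/2) * u\<^sup>2)"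
    by (intro mult_left_mono E) auto
  also have "\<dots> = norm x powr p + p powr (5/2) * norm x powr (p - 2) * (norm v)\<^sup>2"
    using x u by (simp add: powr_diff field_simps power_mult_distrib)
  also have "\<dots> \<le> \<dots> + (1 + 4 * p / ln p) powr p * norm v powr p" by simp
  finally show ?thesis .
qed

text \<open>A form of Young's inequality: the left-hand side is a weighted geometric mean of the two
  terms on the right, hence at most the larger of them.\<close>

lemma powr_mult_le_add:
  fixes x y p :: real
  assumes "2 \<le> p" "0 \<le> x" "0 \<le> y"
  shows "x powr (p - 2) * y \<le> x powr p + y powr (p / 2)"
proof (cases "y \<le> x\<^sup>2")
  case True
  show ?thesis
  proof (cases "x = 0")
    case False
    then have "x powr (p - 2) * y \<le> x powr (p - 2) * x\<^sup>2"
      using True by (intro mult_left_mono) auto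
    also have "\<dots> = x powr p" using False assms by (simp add: powr_diff)
    finally show ?thesis by (smt (verit) powr_ge_zero)
  qed simp
next
  case False
  then have y: "0 < y" by (smt (verit) zero_le_power2)
  have "x \<le> sqrt y" using False real_le_rsqrt by fastforce
  then have "x powr (p - 2) * y \<le> sqrt y powr (p - 2) * y"
    using assms by (intro mult_right_mono powr_mono2) auto
  also have "sqrt y powr (p - 2) = y powr (p / 2 - 1)"
    using y by (simp add: powr_powr diff_divide_distrib flip: powr_half_sqrt)
  also have "y powr (p / 2 - 1) * y = y powr (p / 2)" using y by (simp add: powr_diff)
  finally show ?thesis by (smt (verit) powr_ge_zero)
qed

section \<open>Averages over cylinders of the cube\<close>

lemma avg_mono:
  fixes f g :: "'b \<Rightarrow> real"
  assumes "\<And>x. x \<in> X \<Longrightarrow> f x \<le> g x"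
  shows "avg X f \<le> avg X g"
  using assms by (simp add: avg_def sum_mono mult_left_mono)

lemma avg_cong: "(\<And>x. x \<in> X \<Longrightarrow> f x = g x) \<Longrightarrow> avg X f = avg X g"
  by (simp add: avg_def)

lemma avg_add: "avg X (\<lambda>x. f x + g x) = avg X f + avg X g"
  by (simp add: avg_def sum.distrib scaleR_add_right)

lemma avg_mult_left: "avg X (\<lambda>x. c * f x) = c * avg X f" for f :: "'b \<Rightarrow> real"
  by (simp add: avg_def flip: sum_distrib_left)

lemma avg_sum: "avg X (\<lambda>x. \<Sum>j\<in>J. f j x) = (\<Sum>j\<in>J. avg X (f j))"
  unfolding avg_def by (subst sum.swap) (simp add: scaleR_sum_right)

lemma avg_nonneg: "(\<And>x. x \<in> X \<Longrightarrow> 0 \<le> f x) \<Longrightarrow> 0 \<le> avg X f" for f :: "'b \<Rightarrow> real"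
  by (simp add: avg_def sum_nonneg)

lemma norm_avg_le: "norm (avg X f) \<le> avg X (\<lambda>x. norm (f x))"
  by (simp add: avg_def mult_left_mono norm_sum)

text \<open>Jensen's inequality, obtained by averaging the tangent bound at the mean of \<open>f\<close>.\<close>

lemma avg_powr_le:
  fixes f :: "'b \<Rightarrow> real"
  assumes "finite X" "X \<noteq> {}" and q: "1 \<le> q" and f: "\<And>x. x \<in> X \<Longrightarrow> 0 \<le> f x"
  shows "avg X f powr q \<le> avg X (\<lambda>x. f x powr q)"
proof (cases "avg X f = 0")
  case True
  then show ?thesis by (simp add: avg_nonneg)
next
  case False
  define m where "m = avg X f"
  have m: "0 < m" using False avg_nonneg[of X f] f by (simp add: m_def)
  have card: "0 < real (card X)" using assms by (simp add: card_gt_0_iff)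
  have "(\<Sum>x\<in>X. m powr q + q * m powr (q - 1) * (f x - m)) = real (card X) * m powr q"
  proof -
    have "sum f X = real (card X) * m"
      using card by (simp add: m_def avg_def)
    then show ?thesis
      by (simp add: sum.distrib sum_subtractf flip: sum_distrib_left)
  qed
  moreover have "(\<Sum>x\<in>X. m powr q + q * m powr (q - 1) * (f x - m)) \<le> (\<Sum>x\<in>X. f x powr q)"
    using q m f by (intro sum_mono powr_above_tangent)
  ultimately show ?thesis
    using card unfolding m_def[symmetric] by (simp add: avg_def field_simps)
qed

lemma Lnorm_powr:
  assumes "0 < p"
  shows "Lnorm n p h powr p = expec n (\<lambda>\<epsilon>. norm (h \<epsilon>) powr p)"
  using assms avg_nonneg[of "cube n" "\<lambda>\<epsilon>. norm (h \<epsilon>) powr p"] by (simp add: Lnorm_def powr_powr)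

definition cylinder :: "nat \<Rightarrow> nat set \<Rightarrow> (nat \<Rightarrow> real) \<Rightarrow> (nat \<Rightarrow> real) set" where
  "cylinder n S \<epsilon> = {\<eta> \<in> cube n. \<forall>j\<in>S. \<eta> j = \<epsilon> j}"

lemma proj_eq: "proj n S h \<epsilon> = avg (cylinder n S \<epsilon>) h"
  by (simp add: proj_def cylinder_def)

lemma finite_cube: "finite (cube n)"
  by (simp add: cube_def finite_PiE)

lemma finite_cylinder: "finite (cylinder n S \<epsilon>)"
  by (simp add: cylinder_def finite_cube)

lemma cylinder_empty: "cylinder n {} \<epsilon> = cube n"
  by (simp add: cylinder_def)

lemma self_in_cylinder: "\<epsilon> \<in> cube n \<Longrightarrow> \<epsilon> \<in> cylinder n S \<epsilon>"
  by (simp add: cylinder_def)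

lemma cylinder_subset_cube: "cylinder n S \<epsilon> \<subseteq> cube n"
  by (auto simp: cylinder_def)

lemma card_cylinder_pos: "\<epsilon> \<in> cube n \<Longrightarrow> 0 < card (cylinder n S \<epsilon>)"
  using self_in_cylinder finite_cylinder card_gt_0_iff by blast

lemma cylinder_eq: "\<eta> \<in> cylinder n S \<epsilon> \<Longrightarrow> cylinder n S \<eta> = cylinder n S \<epsilon>"
  by (auto simp: cylinder_def)

lemma cylinder_update: "j \<notin> S \<Longrightarrow> cylinder n S (\<epsilon>(j := x)) = cylinder n S \<epsilon>"
  unfolding cylinder_def by (intro Collect_cong conj_cong refl ball_cong) auto

lemma cube_coord: "\<epsilon> \<in> cube n \<Longrightarrow> j \<in> {1..n} \<Longrightarrow> \<epsilon> j = 1 \<or> \<epsilon> j = -1"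
  by (auto simp: cube_def PiE_iff)

lemma flip_in_cube: "\<epsilon> \<in> cube n \<Longrightarrow> j \<in> {1..n} \<Longrightarrow> \<epsilon>(j := - \<epsilon> j) \<in> cube n"
  by (auto simp: cube_def PiE_iff extensional_def)

text \<open>Changing the sign of a free coordinate permutes a cylinder; this is the source of all
  orthogonality relations below.\<close>

lemma sum_cylinder_flip:
  assumes "j \<in> {1..n}" "j \<notin> S"
  shows "(\<Sum>\<eta>\<in>cylinder n S \<epsilon>. F (\<eta>(j := - \<eta> j))) = (\<Sum>\<eta>\<in>cylinder n S \<epsilon>. F \<eta>)"
proof -
  have "\<eta>(j := - \<eta> j) \<in> cylinder n S \<epsilon>" if "\<eta> \<in> cylinder n S \<epsilon>" for \<eta>
    using that assms flip_in_cube[of \<eta> n j] by (auto simp: cylinder_def)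
  then show ?thesis
    by (intro sum.reindex_bij_witness[of _ "\<lambda>\<eta>. \<eta>(j := - \<eta> j)" "\<lambda>\<eta>. \<eta>(j := - \<eta> j)"]) auto
qed

lemma proj_mono:
  fixes f g :: "(nat \<Rightarrow> real) \<Rightarrow> real"
  assumes "\<And>\<eta>. \<eta> \<in> cube n \<Longrightarrow> f \<eta> \<le> g \<eta>"
  shows "proj n S f \<epsilon> \<le> proj n S g \<epsilon>"
  unfolding proj_eq using assms cylinder_subset_cube by (intro avg_mono) blast

lemma proj_powr_le:
  fixes f :: "(nat \<Rightarrow> real) \<Rightarrow> real"
  assumes "\<epsilon> \<in> cube n" "1 \<le> q" "\<And>\<eta>. 0 \<le> f \<eta>"
  shows "proj n S f \<epsilon> powr q \<le> proj n S (\<lambda>\<eta>. f \<eta> powr q) \<epsilon>"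
  unfolding proj_eq using assms finite_cylinder card_cylinder_pos[of \<epsilon> n S]
  by (intro avg_powr_le) (auto simp: card_gt_0_iff)

text \<open>Conditional averages preserve the mean. Membership of one point in the cylinder of another
  is a symmetric relation and cylinders of related points coincide, so exchanging the two
  summations makes the normalisation cancel.\<close>

lemma expec_proj: "expec n (proj n S g) = expec n g"
proof -
  have "(\<Sum>\<epsilon>\<in>cube n. proj n S g \<epsilon>)
      = (\<Sum>\<epsilon>\<in>cube n. \<Sum>\<eta>\<in>{\<eta> \<in> cube n. \<eta> \<in> cylinder n S \<epsilon>}. g \<eta> /\<^sub>R real (card (cylinder n S \<epsilon>)))"
    unfolding proj_eq avg_def scaleR_sum_right
    by (intro sum.cong refl) (auto simp: cylinder_def)
  also have "\<dots> = (\<Sum>\<eta>\<in>cube n. \<Sum>\<epsilon>\<in>{\<epsilon> \<in> cube n. \<eta> \<in> cylinder n S \<epsilon>}. g \<eta> /\<^sub>R real (card (cylinder n S \<epsilon>)))"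
    by (intro sum.swap_restrict finite_cube)
  also have "\<dots> = (\<Sum>\<eta>\<in>cube n. g \<eta>)"
  proof (intro sum.cong refl)
    fix \<eta> assume \<eta>: "\<eta> \<in> cube n"
    have "{\<epsilon> \<in> cube n. \<eta> \<in> cylinder n S \<epsilon>} = cylinder n S \<eta>"
      using \<eta> by (auto simp: cylinder_def)
    then have "(\<Sum>\<epsilon>\<in>{\<epsilon> \<in> cube n. \<eta> \<in> cylinder n S \<epsilon>}. g \<eta> /\<^sub>R real (card (cylinder n S \<epsilon>)))
        = (\<Sum>\<epsilon>\<in>cylinder n S \<eta>. g \<eta> /\<^sub>R real (card (cylinder n S \<eta>)))"
      by (intro sum.cong) (auto simp: cylinder_eq)
    also have "\<dots> = g \<eta>"
      using card_cylinder_pos[OF \<eta>, of S] by (simp add: sum_constant_scaleR)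
    finally show "(\<Sum>\<epsilon>\<in>{\<epsilon> \<in> cube n. \<eta> \<in> cylinder n S \<epsilon>}. g \<eta> /\<^sub>R real (card (cylinder n S \<epsilon>))) = g \<eta>" .
  qed
  finally show ?thesis by (simp add: avg_def)
qed

section \<open>Revealing one coordinate\<close>

text \<open>For \<open>j \<notin> T\<close> this is the Walsh coefficient at \<open>{j}\<close> of the restriction of \<open>h\<close> to the
  subcube obtained by fixing the coordinates in \<open>T\<close>.\<close>

definition cond_coeff :: "nat \<Rightarrow> nat set \<Rightarrow> nat \<Rightarrow> ((nat \<Rightarrow> real) \<Rightarrow> 'a::real_vector) \<Rightarrow> (nat \<Rightarrow> real) \<Rightarrow> 'a" where
  "cond_coeff n T j h = proj n T (\<lambda>\<eta>. \<eta> j *\<^sub>R h \<eta>)"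

lemma sum_cylinder_coord:
  assumes "j \<in> {1..n}" "j \<notin> T"
  shows "(\<Sum>\<eta>\<in>cylinder n T \<epsilon>. \<eta> j) = 0"
  using sum_cylinder_flip[OF assms, of "\<lambda>\<eta>. \<eta> j" \<epsilon>] by (simp add: sum_negf)

text \<open>The weight \<open>1 + \<epsilon> j * \<eta> j\<close> is twice the indicator of \<open>\<eta> j = \<epsilon> j\<close>.\<close>

lemma sum_cylinder_insert:
  fixes F :: "(nat \<Rightarrow> real) \<Rightarrow> 'a::real_vector"
  assumes \<epsilon>: "\<epsilon> \<in> cube n" and j: "j \<in> {1..n}"
  shows "(\<Sum>\<eta>\<in>cylinder n T \<epsilon>. (1 + \<epsilon> j * \<eta> j) *\<^sub>R F \<eta>) = 2 *\<^sub>R (\<Sum>\<eta>\<in>cylinder n (insert j T) \<epsilon>. F \<eta>)"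
proof -
  let ?C = "cylinder n T \<epsilon>" and ?D = "cylinder n (insert j T) \<epsilon>"
  have D: "?D = {\<eta> \<in> ?C. \<eta> j = \<epsilon> j}" by (auto simp: cylinder_def)
  have "(\<Sum>\<eta>\<in>?C. (1 + \<epsilon> j * \<eta> j) *\<^sub>R F \<eta>) = (\<Sum>\<eta>\<in>?C. if \<eta> j = \<epsilon> j then 2 *\<^sub>R F \<eta> else 0)"
  proof (intro sum.cong refl)
    fix \<eta> assume "\<eta> \<in> ?C"
    then have "\<eta> \<in> cube n" by (simp add: cylinder_def)
    then show "(1 + \<epsilon> j * \<eta> j) *\<^sub>R F \<eta> = (if \<eta> j = \<epsilon> j then 2 *\<^sub>R F \<eta> else 0)"
      using cube_coord[OF _ j, of \<eta>] cube_coord[OF \<epsilon> j] by auto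
  qed
  also have "\<dots> = 2 *\<^sub>R (\<Sum>\<eta>\<in>?D. F \<eta>)"
    by (subst scaleR_sum_right) (simp add: D sum.inter_filter finite_cylinder)
  finally show ?thesis .
qed

lemma card_cylinder_insert:
  assumes \<epsilon>: "\<epsilon> \<in> cube n" and j: "j \<in> {1..n}" "j \<notin> T"
  shows "real (card (cylinder n T \<epsilon>)) = 2 * real (card (cylinder n (insert j T) \<epsilon>))"
  using sum_cylinder_insert[OF \<epsilon> j(1), of "\<lambda>_. 1 :: real" T] sum_cylinder_coord[OF j, of \<epsilon>]
  by (simp add: sum.distrib flip: sum_distrib_left)

text \<open>Revealing the coordinate \<open>j\<close> adds a martingale difference that is a random sign times a
  quantity depending only on the coordinates already revealed.\<close>

lemma proj_insert:
  fixes h :: "(nat \<Rightarrow> real) \<Rightarrow> 'a::real_vector"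
  assumes \<epsilon>: "\<epsilon> \<in> cube n" and j: "j \<in> {1..n}" "j \<notin> T"
  shows "proj n (insert j T) h \<epsilon> = proj n T h \<epsilon> + \<epsilon> j *\<^sub>R cond_coeff n T j h \<epsilon>"
proof -
  let ?C = "cylinder n T \<epsilon>"
  have "proj n T h \<epsilon> + \<epsilon> j *\<^sub>R cond_coeff n T j h \<epsilon> = (\<Sum>\<eta>\<in>?C. (1 + \<epsilon> j * \<eta> j) *\<^sub>R h \<eta>) /\<^sub>R real (card ?C)"
    by (simp add: proj_eq cond_coeff_def avg_def scaleR_sum_right sum.distrib algebra_simps)
  also have "\<dots> = proj n (insert j T) h \<epsilon>"
    by (simp add: sum_cylinder_insert[OF \<epsilon> j(1)] card_cylinder_insert[OF \<epsilon> j] proj_eq avg_def)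
  finally show ?thesis ..
qed

text \<open>Bessel's inequality on the subcube, for the orthonormal system of its free coordinates.\<close>

lemma cond_coeff_bessel:
  fixes h :: "(nat \<Rightarrow> real) \<Rightarrow> 'a::real_inner"
  assumes \<epsilon>: "\<epsilon> \<in> cube n"
  shows "(\<Sum>j\<in>{1..n} - T. (norm (cond_coeff n T j h \<epsilon>))\<^sup>2) \<le> proj n T (\<lambda>\<eta>. (norm (h \<eta>))\<^sup>2) \<epsilon>"
proof -
  let ?C = "cylinder n T \<epsilon>" and ?J = "{1..n} - T" and ?N = "real (card (cylinder n T \<epsilon>))"
  define w where "w j = cond_coeff n T j h \<epsilon>" for j
  define s where "s \<eta> = (\<Sum>j\<in>?J. \<eta> j *\<^sub>R w j)" for \<eta> :: "nat \<Rightarrow> real"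
  define E where "E = (\<Sum>j\<in>?J. (norm (w j))\<^sup>2)"
  have N: "0 < ?N" using card_cylinder_pos[OF \<epsilon>] by simp
  have w: "(\<Sum>\<eta>\<in>?C. \<eta> j *\<^sub>R h \<eta>) = ?N *\<^sub>R w j" for j
    using N by (simp add: w_def cond_coeff_def proj_eq avg_def)
  have hs: "(\<Sum>\<eta>\<in>?C. h \<eta> \<bullet> s \<eta>) = ?N * E"
  proof -
    have "(\<Sum>\<eta>\<in>?C. h \<eta> \<bullet> s \<eta>) = (\<Sum>j\<in>?J. (\<Sum>\<eta>\<in>?C. \<eta> j *\<^sub>R h \<eta>) \<bullet> w j)"
      unfolding s_def inner_sum_right inner_sum_left by (subst sum.swap) simp
    then show ?thesis
      by (simp add: w E_def sum_distrib_left power2_norm_eq_inner)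
  qed
  have orth: "(\<Sum>\<eta>\<in>?C. \<eta> i * \<eta> j) = (if i = j then ?N else 0)" if ij: "i \<in> ?J" "j \<in> ?J" for i j
  proof (cases "i = j")
    case True
    have "\<eta> i * \<eta> i = 1" if "\<eta> \<in> ?C" for \<eta>
      using cube_coord[of \<eta> n i] that ij by (auto simp: cylinder_def)
    then show ?thesis using True by simp
  next
    case False
    then show ?thesis
      using sum_cylinder_flip[of i n T "\<lambda>\<eta>. \<eta> i * \<eta> j" \<epsilon>] ij by (simp add: sum_negf)
  qed
  have ss: "(\<Sum>\<eta>\<in>?C. s \<eta> \<bullet> s \<eta>) = ?N * E"
  proof -
    have "(\<Sum>\<eta>\<in>?C. s \<eta> \<bullet> s \<eta>) = (\<Sum>\<eta>\<in>?C. \<Sum>i\<in>?J. \<Sum>j\<in>?J. (\<eta> i * \<eta> j) * (w j \<bullet> w i))"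
      by (simp add: s_def inner_sum_left inner_sum_right sum_distrib_left mult.assoc)
    also have "\<dots> = (\<Sum>i\<in>?J. \<Sum>j\<in>?J. (\<Sum>\<eta>\<in>?C. \<eta> i * \<eta> j) * (w j \<bullet> w i))"
      by (subst sum.swap, intro sum.cong refl, subst sum.swap, simp add: sum_distrib_right)
    also have "\<dots> = (\<Sum>i\<in>?J. \<Sum>j\<in>?J. if i = j then ?N * (w j \<bullet> w i) else 0)"
      by (intro sum.cong refl) (simp add: orth)
    also have "\<dots> = ?N * E"
      by (simp add: E_def sum_distrib_left power2_norm_eq_inner)
    finally show ?thesis .
  qed
  \<comment> \<open>The linear part \<open>s\<close> is the orthogonal projection of \<open>h\<close>; its residual has nonnegative norm.\<close>
  have "0 \<le> (\<Sum>\<eta>\<in>?C. (norm (h \<eta> - s \<eta>))\<^sup>2)" by (simp add: sum_nonneg)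
  also have "\<dots> = (\<Sum>\<eta>\<in>?C. (norm (h \<eta>))\<^sup>2) - 2 * (\<Sum>\<eta>\<in>?C. h \<eta> \<bullet> s \<eta>) + (\<Sum>\<eta>\<in>?C. s \<eta> \<bullet> s \<eta>)"
    unfolding sum_distrib_left sum_subtractf[symmetric] sum.distrib[symmetric]
    by (intro sum.cong refl)
      (simp add: power2_norm_eq_inner inner_diff_left inner_diff_right inner_commute)
  finally have "?N * E \<le> (\<Sum>\<eta>\<in>?C. (norm (h \<eta>))\<^sup>2)" by (simp add: hs ss mult.commute[of E])
  then show ?thesis
    using N by (simp add: proj_eq avg_def E_def w_def field_simps)
qed

text \<open>A coefficient at \<open>{j}\<close> only sees the part of \<open>h\<close> that is odd in the coordinate \<open>j\<close>, which
  is half of \<^term>\<open>flip_diff j h\<close>; Jensen's inequality does the rest.\<close>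

lemma norm_cond_coeff_powr_le:
  fixes h :: "(nat \<Rightarrow> real) \<Rightarrow> 'a::real_normed_vector"
  assumes \<epsilon>: "\<epsilon> \<in> cube n" and j: "j \<in> {1..n}" "j \<notin> T" and p: "1 \<le> p"
  shows "norm (cond_coeff n T j h \<epsilon>) powr p \<le> proj n T (\<lambda>\<eta>. norm (flip_diff j h \<eta>) powr p) \<epsilon>"
proof -
  let ?C = "cylinder n T \<epsilon>"
  have "(\<Sum>\<eta>\<in>?C. \<eta> j *\<^sub>R h (\<eta>(j := - \<eta> j))) = - (\<Sum>\<eta>\<in>?C. \<eta> j *\<^sub>R h \<eta>)"
    using sum_cylinder_flip[OF j, of "\<lambda>\<eta>. \<eta> j *\<^sub>R h \<eta>" \<epsilon>, symmetric] by (simp add: sum_negf)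
  then have "(\<Sum>\<eta>\<in>?C. \<eta> j *\<^sub>R flip_diff j h \<eta>) = 2 *\<^sub>R (\<Sum>\<eta>\<in>?C. \<eta> j *\<^sub>R h \<eta>)"
    by (simp add: flip_diff_def scaleR_diff_right sum_subtractf scaleR_2)
  then have eq: "2 *\<^sub>R cond_coeff n T j h \<epsilon> = proj n T (\<lambda>\<eta>. \<eta> j *\<^sub>R flip_diff j h \<eta>) \<epsilon>"
    by (simp add: cond_coeff_def proj_eq avg_def scaleR_left_commute)
  have "norm (cond_coeff n T j h \<epsilon>) \<le> norm (2 *\<^sub>R cond_coeff n T j h \<epsilon>)" by simp
  also have "\<dots> \<le> proj n T (\<lambda>\<eta>. norm (\<eta> j *\<^sub>R flip_diff j h \<eta>)) \<epsilon>"
    unfolding eq proj_eq by (rule norm_avg_le)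
  also have "\<dots> \<le> proj n T (\<lambda>\<eta>. norm (flip_diff j h \<eta>)) \<epsilon>"
    using cube_coord[OF _ j(1)] by (intro proj_mono) force
  finally have "norm (cond_coeff n T j h \<epsilon>) powr p \<le> proj n T (\<lambda>\<eta>. norm (flip_diff j h \<eta>)) \<epsilon> powr p"
    using p by (intro powr_mono2) auto
  also have "\<dots> \<le> proj n T (\<lambda>\<eta>. norm (flip_diff j h \<eta>) powr p) \<epsilon>"
    using \<epsilon> p by (intro proj_powr_le) auto
  finally show ?thesis .
qed

lemma expec_flip:
  assumes "j \<in> {1..n}"
  shows "expec n (\<lambda>\<epsilon>. F (\<epsilon>(j := - \<epsilon> j))) = expec n F"
  using sum_cylinder_flip[of j n "{}" F] assms by (simp add: avg_def cylinder_empty)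

text \<open>Averaging over the sign of the new coordinate symmetrises the increment.\<close>

lemma expec_proj_insert:
  fixes h :: "(nat \<Rightarrow> real) \<Rightarrow> 'a::real_normed_vector"
  assumes j: "j \<in> {1..n}" "j \<notin> T"
  shows "expec n (\<lambda>\<epsilon>. norm (proj n (insert j T) h \<epsilon>) powr p)
    = expec n (\<lambda>\<epsilon>. (norm (proj n T h \<epsilon> + cond_coeff n T j h \<epsilon>) powr p
                    + norm (proj n T h \<epsilon> - cond_coeff n T j h \<epsilon>) powr p) / 2)"
proof -
  let ?g = "\<lambda>\<epsilon>. norm (proj n T h \<epsilon> + \<epsilon> j *\<^sub>R cond_coeff n T j h \<epsilon>) powr p"
  have "expec n (\<lambda>\<epsilon>. norm (proj n (insert j T) h \<epsilon>) powr p) = expec n ?g"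
    using j by (intro avg_cong) (simp add: proj_insert)
  also have "\<dots> = (expec n ?g + expec n (\<lambda>\<epsilon>. ?g (\<epsilon>(j := - \<epsilon> j)))) / 2"
    by (simp only: expec_flip[OF j(1), of ?g]) simp
  also have "\<dots> = expec n (\<lambda>\<epsilon>. 1 / 2 * (?g \<epsilon> + ?g (\<epsilon>(j := - \<epsilon> j))))"
    by (simp only: avg_add avg_mult_left)
  also have "\<dots> = expec n (\<lambda>\<epsilon>. (norm (proj n T h \<epsilon> + cond_coeff n T j h \<epsilon>) powr p
                    + norm (proj n T h \<epsilon> - cond_coeff n T j h \<epsilon>) powr p) / 2)"
  proof (intro avg_cong)
    fix \<epsilon> assume "\<epsilon> \<in> cube n"
    then have "\<epsilon> j = 1 \<or> \<epsilon> j = -1" using j cube_coord by blast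
    then show "1 / 2 * (?g \<epsilon> + ?g (\<epsilon>(j := - \<epsilon> j))) = (norm (proj n T h \<epsilon> + cond_coeff n T j h \<epsilon>) powr p
                    + norm (proj n T h \<epsilon> - cond_coeff n T j h \<epsilon>) powr p) / 2"
      using j by (auto simp: proj_eq cond_coeff_def cylinder_update)
  qed
  finally show ?thesis .
qed

section \<open>Revealing a random coordinate\<close>

definition subsets_of_size :: "nat \<Rightarrow> nat \<Rightarrow> nat set set" where
  "subsets_of_size n i = {S. S \<subseteq> {1..n} \<and> card S = i}"

lemma finite_subsets_of_size: "finite (subsets_of_size n i)"
  by (simp add: subsets_of_size_def)

lemma card_subsets_of_size: "card (subsets_of_size n i) = n choose i"
  using n_subsets[of "{1..n}" i] by (simp add: subsets_of_size_def)

text \<open>A set of size \<open>Suc i\<close> arises from exactly \<open>Suc i\<close> pairs of a set of size \<open>i\<close> and a new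
  element. In probabilistic terms, a uniform set of size \<open>Suc i\<close> is a uniform set of size
  \<open>i\<close> together with a uniform further point.\<close>

lemma sum_subsets_Suc:
  fixes F :: "nat set \<Rightarrow> real"
  shows "real (Suc i) * (\<Sum>S\<in>subsets_of_size n (Suc i). F S)
    = (\<Sum>T\<in>subsets_of_size n i. \<Sum>j\<in>{1..n} - T. F (insert j T))"
proof -
  have fin: "finite S" if "S \<in> subsets_of_size n m" for S m
    using that finite_subset[of S "{1..n}"] by (auto simp: subsets_of_size_def)
  have "real (Suc i) * (\<Sum>S\<in>subsets_of_size n (Suc i). F S)
      = (\<Sum>S\<in>subsets_of_size n (Suc i). \<Sum>j\<in>S. F S)"
    by (simp add: sum_distrib_left subsets_of_size_def)
  also have "\<dots> = (\<Sum>(S, j)\<in>(SIGMA S:subsets_of_size n (Suc i). S). F S)"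
    using fin finite_subsets_of_size by (subst sum.Sigma) auto
  also have "\<dots> = (\<Sum>(T, j)\<in>(SIGMA T:subsets_of_size n i. {1..n} - T). F (insert j T))"
  proof (rule sum.reindex_bij_witness[of _ "\<lambda>(T, j). (insert j T, j)" "\<lambda>(S, j). (S - {j}, j)"])
    fix x assume "x \<in> (SIGMA S:subsets_of_size n (Suc i). S)"
    then obtain S j where x: "x = (S, j)" "S \<in> subsets_of_size n (Suc i)" "j \<in> S" by blast
    then have ins: "insert j (S - {j}) = S" by blast
    have "S - {j} \<in> subsets_of_size n i" "j \<in> {1..n} - (S - {j})"
      using x fin[OF x(2)] by (auto simp: subsets_of_size_def)
    then show "(case case x of (S, j) \<Rightarrow> (S - {j}, j) of (T, j) \<Rightarrow> (insert j T, j)) = x"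
      "(case x of (S, j) \<Rightarrow> (S - {j}, j)) \<in> (SIGMA T:subsets_of_size n i. {1..n} - T)"
      "(case case x of (S, j) \<Rightarrow> (S - {j}, j) of (T, j) \<Rightarrow> F (insert j T)) = (case x of (S, j) \<Rightarrow> F S)"
      unfolding x(1) prod.case ins by blast+
  next
    fix x assume "x \<in> (SIGMA T:subsets_of_size n i. {1..n} - T)"
    then obtain T j where x: "x = (T, j)" "T \<in> subsets_of_size n i" "j \<in> {1..n} - T" by blast
    then have ins: "insert j T - {j} = T" by blast
    have "insert j T \<in> subsets_of_size n (Suc i)"
      using x fin[OF x(2)] by (simp add: subsets_of_size_def)
    then show "(case case x of (T, j) \<Rightarrow> (insert j T, j) of (S, j) \<Rightarrow> (S - {j}, j)) = x"
      "(case x of (T, j) \<Rightarrow> (insert j T, j)) \<in> (SIGMA S:subsets_of_size n (Suc i). S)"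
      unfolding x(1) prod.case ins by blast+
  qed
  also have "\<dots> = (\<Sum>T\<in>subsets_of_size n i. \<Sum>j\<in>{1..n} - T. F (insert j T))"
    using finite_subsets_of_size by (subst sum.Sigma) auto
  finally show ?thesis .
qed

lemma sum_subsets_complement:
  fixes G :: "nat \<Rightarrow> real"
  shows "(\<Sum>T\<in>subsets_of_size n i. \<Sum>j\<in>{1..n} - T. G j) = real ((n - 1) choose i) * (\<Sum>j=1..n. G j)"
proof -
  have "(\<Sum>T\<in>subsets_of_size n i. \<Sum>j\<in>{1..n} - T. G j)
      = (\<Sum>T\<in>subsets_of_size n i. \<Sum>j\<in>{j \<in> {1..n}. j \<notin> T}. G j)"
    by (intro sum.cong refl) auto
  also have "\<dots> = (\<Sum>j=1..n. \<Sum>T\<in>{T \<in> subsets_of_size n i. j \<notin> T}. G j)"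
    by (intro sum.swap_restrict finite_subsets_of_size) auto
  also have "\<dots> = (\<Sum>j=1..n. real ((n - 1) choose i) * G j)"
  proof (intro sum.cong refl)
    fix j assume j: "j \<in> {1..n}"
    have "{T \<in> subsets_of_size n i. j \<notin> T} = {T. T \<subseteq> {1..n} - {j} \<and> card T = i}"
      by (auto simp: subsets_of_size_def)
    then have "card {T \<in> subsets_of_size n i. j \<notin> T} = (n - 1) choose i"
      using n_subsets[of "{1..n} - {j}" i] j by simp
    then show "(\<Sum>T\<in>{T \<in> subsets_of_size n i. j \<notin> T}. G j) = real ((n - 1) choose i) * G j"
      by simp
  qed
  finally show ?thesis by (simp add: sum_distrib_left)
qed

definition sampled_moment :: "nat \<Rightarrow> nat \<Rightarrow> real \<Rightarrow> ((nat \<Rightarrow> real) \<Rightarrow> 'a::real_normed_vector) \<Rightarrow> real" where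
  "sampled_moment n i p h = avg (subsets_of_size n i) (\<lambda>S. expec n (\<lambda>\<epsilon>. norm (proj n S h \<epsilon>) powr p))"

lemma sum_sampled_moment:
  assumes "i \<le> n"
  shows "(\<Sum>S\<in>subsets_of_size n i. expec n (\<lambda>\<epsilon>. norm (proj n S h \<epsilon>) powr p))
    = real (n choose i) * sampled_moment n i p h"
  using assms by (simp add: sampled_moment_def avg_def card_subsets_of_size)

lemma expec_proj_powr_le:
  fixes f :: "(nat \<Rightarrow> real) \<Rightarrow> real"
  assumes "1 \<le> q" "\<And>\<eta>. 0 \<le> f \<eta>"
  shows "expec n (\<lambda>\<epsilon>. proj n S f \<epsilon> powr q) \<le> expec n (\<lambda>\<eta>. f \<eta> powr q)"
proof -
  have "expec n (\<lambda>\<epsilon>. proj n S f \<epsilon> powr q) \<le> expec n (proj n S (\<lambda>\<eta>. f \<eta> powr q))"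
    using assms by (intro avg_mono proj_powr_le)
  then show ?thesis by (simp add: expec_proj)
qed

text \<open>One random coordinate is revealed after the set \<open>T\<close>. Summed over the new coordinate, the
  squared increments are controlled by Bessel's inequality, pointwise in \<open>\<epsilon>\<close>, by the
  conditional average of \<open>(norm (h \<eta>))\<^sup>2\<close>; this is where randomness of the
  coordinate gains the factor \<open>1 / (n - i)\<close>. The resulting mixed term is split by
  Young's inequality, with a weight \<open>r\<close> that is to be of order \<open>p / k\<close> so that the growth
  factor over \<open>k\<close> steps is only \<open>exp p\<close>.\<close>

lemma sum_expec_proj_insert_le:
  fixes h :: "(nat \<Rightarrow> real) \<Rightarrow> 'a::real_inner"
  assumes p: "2 \<le> p" and T: "T \<in> subsets_of_size n i" and i: "i < n" and r: "0 < r"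
  shows "(\<Sum>j\<in>{1..n} - T. expec n (\<lambda>\<epsilon>. norm (proj n (insert j T) h \<epsilon>) powr p))
    \<le> real (n - i) * ((1 + r) * expec n (\<lambda>\<epsilon>. norm (proj n T h \<epsilon>) powr p)
        + r * (p powr (5/2) / (real (n - i) * r)) powr (p / 2) * expec n (\<lambda>\<epsilon>. norm (h \<epsilon>) powr p))
      + (1 + 4 * p / ln p) powr p * (\<Sum>j\<in>{1..n} - T. expec n (\<lambda>\<epsilon>. norm (flip_diff j h \<epsilon>) powr p))"
proof -
  let ?J = "{1..n} - T" and ?K = "(1 + 4 * p / ln p) powr p" and ?m = "real (n - i)"
  define f where "f = proj n T h"
  define w where "w j = cond_coeff n T j h" for j
  define y where "y = proj n T (\<lambda>\<eta>. (norm (h \<eta>))\<^sup>2)"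
  \<comment> \<open>Scaled so that the mixed term is \<open>m * r\<close> times a product to which the Young bound applies.\<close>
  define \<beta> where "\<beta> = p powr (5/2) / (?m * r)"
  have m: "0 < ?m" using i by simp
  have \<beta>: "0 \<le> \<beta>" "p powr (5/2) = ?m * r * \<beta>" using m r by (auto simp: \<beta>_def)
  have card: "card ?J = n - i"
    using T finite_subset[of T "{1..n}"] by (simp add: subsets_of_size_def card_Diff_subset)
  have y0: "0 \<le> y \<epsilon>" for \<epsilon>
    by (simp add: y_def proj_eq avg_nonneg)
  have Ey: "expec n (\<lambda>\<epsilon>. y \<epsilon> powr (p / 2)) \<le> expec n (\<lambda>\<epsilon>. norm (h \<epsilon>) powr p)"
    using expec_proj_powr_le[of "p / 2" "\<lambda>\<eta>. (norm (h \<eta>))\<^sup>2" n T] p by (simp add: y_def power2_powr_half)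
  have pointwise: "(\<Sum>j\<in>?J. (norm (f \<epsilon> + w j \<epsilon>) powr p + norm (f \<epsilon> - w j \<epsilon>) powr p) / 2)
      \<le> ?m * ((1 + r) * norm (f \<epsilon>) powr p + r * \<beta> powr (p / 2) * y \<epsilon> powr (p / 2))
        + ?K * (\<Sum>j\<in>?J. norm (w j \<epsilon>) powr p)" if \<epsilon>: "\<epsilon> \<in> cube n" for \<epsilon>
  proof -
    let ?F = "norm (f \<epsilon>)"
    have "(\<Sum>j\<in>?J. (norm (f \<epsilon> + w j \<epsilon>) powr p + norm (f \<epsilon> - w j \<epsilon>) powr p) / 2)
      \<le> (\<Sum>j\<in>?J. ?F powr p + p powr (5/2) * ?F powr (p - 2) * (norm (w j \<epsilon>))\<^sup>2 + ?K * norm (w j \<epsilon>) powr p)"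
      using p by (intro sum_mono symmetrized_powr_le)
    also have "\<dots> = ?m * ?F powr p + p powr (5/2) * ?F powr (p - 2) * (\<Sum>j\<in>?J. (norm (w j \<epsilon>))\<^sup>2)
        + ?K * (\<Sum>j\<in>?J. norm (w j \<epsilon>) powr p)"
      by (simp add: sum.distrib card del: One_nat_def flip: sum_distrib_left)
    also have "p powr (5/2) * ?F powr (p - 2) * (\<Sum>j\<in>?J. (norm (w j \<epsilon>))\<^sup>2) \<le> p powr (5/2) * ?F powr (p - 2) * y \<epsilon>"
      using cond_coeff_bessel[OF \<epsilon>, where T = T and h = h] unfolding w_def y_def by (intro mult_left_mono) auto
    also have "p powr (5/2) * ?F powr (p - 2) * y \<epsilon> = ?m * r * (?F powr (p - 2) * (\<beta> * y \<epsilon>))"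
      by (simp add: \<beta>(2))
    also have "\<dots> \<le> ?m * r * (?F powr p + (\<beta> * y \<epsilon>) powr (p / 2))"
      using p \<beta> y0 r m by (intro mult_left_mono powr_mult_le_add) auto
    also have "(\<beta> * y \<epsilon>) powr (p / 2) = \<beta> powr (p / 2) * y \<epsilon> powr (p / 2)"
      using \<beta> y0 by (simp add: powr_mult)
    also have "?m * ?F powr p + ?m * r * (?F powr p + \<beta> powr (p / 2) * y \<epsilon> powr (p / 2))
        = ?m * ((1 + r) * ?F powr p + r * \<beta> powr (p / 2) * y \<epsilon> powr (p / 2))"
      by algebra
    finally show ?thesis by simp
  qed
  have "(\<Sum>j\<in>?J. expec n (\<lambda>\<epsilon>. norm (proj n (insert j T) h \<epsilon>) powr p))
      = expec n (\<lambda>\<epsilon>. \<Sum>j\<in>?J. (norm (f \<epsilon> + w j \<epsilon>) powr p + norm (f \<epsilon> - w j \<epsilon>) powr p) / 2)"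
    unfolding avg_sum f_def w_def by (intro sum.cong refl expec_proj_insert) auto
  also have "\<dots> \<le> expec n (\<lambda>\<epsilon>. ?m * ((1 + r) * norm (f \<epsilon>) powr p + r * \<beta> powr (p / 2) * y \<epsilon> powr (p / 2))
        + ?K * (\<Sum>j\<in>?J. norm (w j \<epsilon>) powr p))"
    using pointwise by (intro avg_mono)
  also have "\<dots> = ?m * ((1 + r) * expec n (\<lambda>\<epsilon>. norm (f \<epsilon>) powr p)
        + r * \<beta> powr (p / 2) * expec n (\<lambda>\<epsilon>. y \<epsilon> powr (p / 2)))
        + ?K * (\<Sum>j\<in>?J. expec n (\<lambda>\<epsilon>. norm (w j \<epsilon>) powr p))"
    by (simp only: avg_add avg_mult_left avg_sum)
  also have "\<dots> \<le> ?m * ((1 + r) * expec n (\<lambda>\<epsilon>. norm (f \<epsilon>) powr p)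
        + r * \<beta> powr (p / 2) * expec n (\<lambda>\<epsilon>. norm (h \<epsilon>) powr p))
        + ?K * (\<Sum>j\<in>?J. expec n (\<lambda>\<epsilon>. norm (flip_diff j h \<epsilon>) powr p))"
  proof (intro add_mono mult_left_mono sum_mono Ey)
    fix j assume j: "j \<in> ?J"
    have "expec n (\<lambda>\<epsilon>. norm (w j \<epsilon>) powr p) \<le> expec n (proj n T (\<lambda>\<epsilon>. norm (flip_diff j h \<epsilon>) powr p))"
      using j p unfolding w_def by (intro avg_mono norm_cond_coeff_powr_le) auto
    then show "expec n (\<lambda>\<epsilon>. norm (w j \<epsilon>) powr p) \<le> expec n (\<lambda>\<epsilon>. norm (flip_diff j h \<epsilon>) powr p)"
      by (simp add: expec_proj)
  qed (use r in auto)
  finally show ?thesis by (simp add: f_def \<beta>_def)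
qed

text \<open>The previous bound averaged over \<open>T\<close>. A random set of size \<open>i\<close> followed by a random new
  point makes each coordinate the new one with probability \<open>1 / n\<close>, whence the average of
  the influences in the last term.\<close>

lemma sampled_moment_Suc_le:
  fixes h :: "(nat \<Rightarrow> real) \<Rightarrow> 'a::real_inner"
  assumes p: "2 \<le> p" and i: "i < n" and r: "0 < r"
  shows "sampled_moment n (Suc i) p h \<le> (1 + r) * sampled_moment n i p h
      + r * (p powr (5/2) / (real (n - i) * r)) powr (p / 2) * expec n (\<lambda>\<epsilon>. norm (h \<epsilon>) powr p)
      + (1 + 4 * p / ln p) powr p * ((\<Sum>j=1..n. expec n (\<lambda>\<epsilon>. norm (flip_diff j h \<epsilon>) powr p)) / real n)"
proof -
  let ?K = "(1 + 4 * p / ln p) powr p" and ?m = "real (n - i)"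
  define Y where "Y = r * (p powr (5/2) / (?m * r)) powr (p / 2) * expec n (\<lambda>\<epsilon>. norm (h \<epsilon>) powr p)"
  define G where "G j = expec n (\<lambda>\<epsilon>. norm (flip_diff j h \<epsilon>) powr p)" for j
  \<comment> \<open>Number of pairs of a set of size \<open>i\<close> and a new element.\<close>
  define N where "N = ?m * real (n choose i)"
  have N: "0 < N" using i by (simp add: N_def)
  \<comment> \<open>The same pairs, counted by their union and by the new element.\<close>
  have N1: "real (Suc i) * real (n choose Suc i) = N"
  proof -
    have "Suc i * (n choose Suc i) = n * ((n - 1) choose i)"
      using i Suc_times_binomial[of i "n - 1"] by simp
    also have "\<dots> = (n - i) * (n choose i)" by (rule binomial_absorb_comp[symmetric])
    finally show ?thesis unfolding N_def of_nat_mult[symmetric] by (rule arg_cong)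
  qed
  have N2: "real ((n - 1) choose i) = N / real n"
  proof -
    have "N = real n * real ((n - 1) choose i)"
      unfolding N_def of_nat_mult[symmetric] by (simp only: binomial_absorb_comp)
    then show ?thesis using i by simp
  qed
  have "N * sampled_moment n (Suc i) p h
      = real (Suc i) * (\<Sum>S\<in>subsets_of_size n (Suc i). expec n (\<lambda>\<epsilon>. norm (proj n S h \<epsilon>) powr p))"
    using i by (subst sum_sampled_moment) (simp_all add: N1[symmetric])
  also have "\<dots> = (\<Sum>T\<in>subsets_of_size n i. \<Sum>j\<in>{1..n} - T. expec n (\<lambda>\<epsilon>. norm (proj n (insert j T) h \<epsilon>) powr p))"
    by (rule sum_subsets_Suc)
  also have "\<dots> \<le> (\<Sum>T\<in>subsets_of_size n i.
      ?m * ((1 + r) * expec n (\<lambda>\<epsilon>. norm (proj n T h \<epsilon>) powr p) + Y) + ?K * (\<Sum>j\<in>{1..n} - T. G j))"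
    unfolding Y_def G_def using p i r by (intro sum_mono sum_expec_proj_insert_le)
  also have "\<dots> = ?m * ((1 + r) * (\<Sum>T\<in>subsets_of_size n i. expec n (\<lambda>\<epsilon>. norm (proj n T h \<epsilon>) powr p))
      + real (n choose i) * Y) + ?K * (real ((n - 1) choose i) * (\<Sum>j=1..n. G j))"
    by (simp add: sum.distrib card_subsets_of_size sum_subsets_complement del: One_nat_def flip: sum_distrib_left)
  also have "\<dots> = N * ((1 + r) * sampled_moment n i p h + Y + ?K * ((\<Sum>j=1..n. G j) / real n))"
    using i by (simp add: sum_sampled_moment N2 del: One_nat_def) (simp add: N_def algebra_simps)
  finally show ?thesis
    using N unfolding Y_def G_def by (subst (asm) mult_le_cancel_left_pos)
qed

lemma discrete_gronwall:
  fixes a :: "nat \<Rightarrow> real"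
  assumes "a 0 = 0" "0 \<le> r" "0 \<le> c" and step: "\<And>i. i < k \<Longrightarrow> a (Suc i) \<le> (1 + r) * a i + c"
  shows "a k \<le> real k * c * exp (real k * r)"
proof -
  have "a i \<le> real i * c * (1 + r) ^ i" if "i \<le> k" for i
    using that
  proof (induction i)
    case 0
    then show ?case using assms by simp
  next
    case (Suc i)
    have "a (Suc i) \<le> (1 + r) * a i + c" using step Suc by simp
    also have "\<dots> \<le> (1 + r) * (real i * c * (1 + r) ^ i) + c * (1 + r) ^ Suc i"
    proof (intro add_mono mult_left_mono)
      show "a i \<le> real i * c * (1 + r) ^ i" using Suc by simp
      have "1 \<le> (1 + r) ^ Suc i" using assms by (intro one_le_power) auto
      then have "c * 1 \<le> c * (1 + r) ^ Suc i" using assms by (intro mult_left_mono)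
      then show "c \<le> c * (1 + r) ^ Suc i" by simp
    qed (use assms in auto)
    also have "\<dots> = real (Suc i) * c * (1 + r) ^ Suc i" by (simp add: algebra_simps)
    finally show ?case .
  qed
  then have "a k \<le> real k * c * (1 + r) ^ k" by simp
  also have "(1 + r) ^ k \<le> exp r ^ k"
    using assms by (intro power_mono exp_ge_add_one_self) auto
  then have "real k * c * (1 + r) ^ k \<le> real k * c * exp r ^ k"
    using assms by (intro mult_left_mono) auto
  also have "exp r ^ k = exp (real k * r)" by (simp add: exp_of_nat_mult)
  finally show ?thesis .
qed

section \<open>The upper bound\<close>

lemma sampled_moment_0:
  assumes "expec n h = 0"
  shows "sampled_moment n 0 p h = 0"
proof -
  have "subsets_of_size n 0 = {{}}"
    using finite_subset[of _ "{1..n}"] by (auto simp: subsets_of_size_def)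
  moreover have "proj n {} h = (\<lambda>\<epsilon>. 0)"
    using assms by (auto simp: proj_eq cylinder_empty)
  ultimately show ?thesis by (simp add: sampled_moment_def avg_def)
qed

lemma sampled_moment_le_moment:
  assumes "1 \<le> p" "k \<le> n"
  shows "sampled_moment n k p h \<le> expec n (\<lambda>\<epsilon>. norm (h \<epsilon>) powr p)"
proof -
  have "expec n (\<lambda>\<epsilon>. norm (proj n S h \<epsilon>) powr p) \<le> expec n (\<lambda>\<epsilon>. norm (h \<epsilon>) powr p)" for S
  proof -
    have "expec n (\<lambda>\<epsilon>. norm (proj n S h \<epsilon>) powr p) \<le> expec n (\<lambda>\<epsilon>. proj n S (\<lambda>\<eta>. norm (h \<eta>)) \<epsilon> powr p)"
      using assms by (intro avg_mono powr_mono2) (auto simp: proj_eq norm_avg_le)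
    also have "\<dots> \<le> expec n (\<lambda>\<epsilon>. norm (h \<epsilon>) powr p)"
      using assms by (intro expec_proj_powr_le) auto
    finally show ?thesis .
  qed
  then have "sampled_moment n k p h \<le> avg (subsets_of_size n k) (\<lambda>_. expec n (\<lambda>\<epsilon>. norm (h \<epsilon>) powr p))"
    unfolding sampled_moment_def by (rule avg_mono)
  also have "\<dots> = expec n (\<lambda>\<epsilon>. norm (h \<epsilon>) powr p)"
    using assms by (simp add: avg_def[of "subsets_of_size n k"] card_subsets_of_size)
  finally show ?thesis .
qed

lemma sampled_norm_eq: "0 < p \<Longrightarrow> sampled_norm n k p h = sampled_moment n k p h powr (1 / p)"
  unfolding sampled_norm_def sampled_moment_def subsets_of_size_def[symmetric]
    avg_def[of "subsets_of_size n k"] card_subsets_of_size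
  by (simp add: Lnorm_powr divide_inverse mult.commute)

lemma ln_le_self: "0 < p \<Longrightarrow> ln p \<le> (p::real)"
  using ln_le_minus_one[of p] by simp

text \<open>The diffuse part has constant of order \<open>p powr (3/4)\<close>, far below \<open>p / ln p\<close>; the estimate
  reduces to \<open>ln p \<le> 4 * p powr (1/4)\<close>. The factor \<open>exp p * p\<close> only costs \<open>exp 2\<close> after
  taking \<open>p\<close>-th roots.\<close>

lemma diffuse_const_le:
  fixes p :: real
  assumes p: "2 \<le> p"
  shows "exp p * p * (2 * p powr (3/2)) powr (p / 2) \<le> (8 * exp 2 * (p / ln p)) powr p"
proof -
  have lnp: "0 < ln p" using p by simp
  have "ln p = 4 * ln (p powr (1/4))" using p by (simp add: ln_powr)
  also have "\<dots> \<le> 4 * p powr (1/4)" using p ln_le_self[of "p powr (1/4)"] by simp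
  finally have "(ln p)\<^sup>2 \<le> (4 * p powr (1/4))\<^sup>2" using lnp by (intro power_mono) auto
  also have "\<dots> = 16 * p powr (1/2)"
    using p by (simp add: power_mult_distrib power2_eq_square flip: powr_add)
  finally have "p powr (3/2) * (ln p)\<^sup>2 \<le> p powr (3/2) * (16 * p powr (1/2))"
    by (intro mult_left_mono) auto
  also have "\<dots> = 16 * p\<^sup>2"
    using p by (simp flip: powr_add)
  finally have "2 * p powr (3/2) * (ln p)\<^sup>2 \<le> 64 * p\<^sup>2"
    using zero_le_power2[of p] by linarith
  then have "2 * p powr (3/2) \<le> (8 * (p / ln p))\<^sup>2"
    using lnp by (simp add: power_mult_distrib power_divide field_simps)
  then have "(2 * p powr (3/2)) powr (p / 2) \<le> ((8 * (p / ln p))\<^sup>2) powr (p / 2)"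
    using p by (intro powr_mono2) auto
  also have "\<dots> = (8 * (p / ln p)) powr p"
    using p lnp by (simp add: powr_powr flip: powr_numeral)
  finally have A: "(2 * p powr (3/2)) powr (p / 2) \<le> (8 * (p / ln p)) powr p" .
  have "exp p * p \<le> exp p * exp p"
  proof (intro mult_left_mono)
    show "p \<le> exp p" using exp_ge_add_one_self[of p] by linarith
  qed simp
  also have "\<dots> = exp 2 powr p" by (simp add: powr_def flip: exp_add)
  finally have "exp p * p * (2 * p powr (3/2)) powr (p / 2) \<le> exp 2 powr p * (8 * (p / ln p)) powr p"
    using p A by (intro mult_mono) auto
  also have "\<dots> = (8 * exp 2 * (p / ln p)) powr p"
    using p lnp by (simp add: mult_ac flip: powr_mult)
  finally show ?thesis .
qed

lemma jump_const_le:
  fixes p :: real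
  assumes p: "2 \<le> p"
  shows "exp p * (1 + 4 * p / ln p) powr p \<le> (8 * exp 2 * (p / ln p)) powr p"
proof -
  have lnp: "0 < ln p" using p by simp
  have "1 \<le> p / ln p" using p lnp ln_le_self[of p] by simp
  then have "1 + 4 * p / ln p \<le> 8 * (p / ln p)" by simp
  then have "exp 1 * (1 + 4 * p / ln p) \<le> exp 2 * (8 * (p / ln p))"
    using p lnp by (intro mult_mono) auto
  then have "(exp 1 * (1 + 4 * p / ln p)) powr p \<le> (8 * exp 2 * (p / ln p)) powr p"
    using p lnp by (intro powr_mono2) (auto simp: mult_ac)
  moreover have "(exp 1 * (1 + 4 * p / ln p)) powr p = exp p * (1 + 4 * p / ln p) powr p"
    using p lnp by (subst powr_mult) (auto simp: powr_def)
  ultimately show ?thesis by simp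
qed

text \<open>If \<open>2 * k \<le> n\<close>, at least half of the coordinates are free at each of the \<open>k\<close> steps, and the
  recursion with growth rate \<open>r = p / k\<close> gives the claim. Otherwise \<open>k / n\<close> is
  at least \<open>1 / 2\<close> and the second term on the right, times the constant, dominates the \<open>p\<close>-th moment
  of \<open>h\<close>, which conditional averages do not increase.\<close>

lemma sampled_moment_le:
  fixes h :: "(nat \<Rightarrow> real) \<Rightarrow> 'a::real_inner"
  assumes p: "2 \<le> p" and k: "1 \<le> k" "k \<le> n" and h0: "expec n h = 0"
  shows "sampled_moment n k p h \<le> (8 * exp 2 * (p / ln p)) powr p *
    (real k / real n * (\<Sum>j=1..n. expec n (\<lambda>\<epsilon>. norm (flip_diff j h \<epsilon>) powr p))
      + (real k / real n) powr (p / 2) * expec n (\<lambda>\<epsilon>. norm (h \<epsilon>) powr p))"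
proof -
  define D where "D = (\<Sum>j=1..n. expec n (\<lambda>\<epsilon>. norm (flip_diff j h \<epsilon>) powr p))"
  define H where "H = expec n (\<lambda>\<epsilon>. norm (h \<epsilon>) powr p)"
  define M where "M = 8 * exp 2 * (p / ln p)"
  define K where "K = (1 + 4 * p / ln p) powr p"
  define t where "t = real k / real n"
  have lnp: "0 < ln p" using p by simp
  have D: "0 \<le> D" unfolding D_def by (intro sum_nonneg avg_nonneg) auto
  have H: "0 \<le> H" unfolding H_def by (intro avg_nonneg) auto
  have t: "0 < t" using k by (simp add: t_def)
  show ?thesis
  proof (cases "2 * k \<le> n")
    case True
    define r where "r = p / real k"
    define c where "c = r * (2 * p powr (3/2) * t) powr (p / 2) * H + K * (D / real n)"
    have r: "0 < r" using p k by (simp add: r_def)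
    have "sampled_moment n k p h \<le> real k * c * exp (real k * r)"
    proof (rule discrete_gronwall)
      show "sampled_moment n 0 p h = 0" by (rule sampled_moment_0[OF h0])
      show "0 \<le> c" using r D H by (simp add: c_def K_def)
      fix i assume i: "i < k"
      have "sampled_moment n (Suc i) p h \<le> (1 + r) * sampled_moment n i p h
          + r * (p powr (5/2) / (real (n - i) * r)) powr (p / 2) * H + K * (D / real n)"
        unfolding H_def K_def D_def using p i k r by (intro sampled_moment_Suc_le) auto
      also have "r * (p powr (5/2) / (real (n - i) * r)) powr (p / 2) * H
          \<le> r * (2 * p powr (3/2) * t) powr (p / 2) * H"
      proof -
        \<comment> \<open>Fewer than half of the coordinates have been revealed so far.\<close>
        have "real n \<le> 2 * real (n - i)" using True i by linarith
        then have "p powr (5/2) / (real (n - i) * r) \<le> p powr (5/2) / (real n / 2 * r)"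
          using k r i by (intro divide_left_mono mult_right_mono mult_pos_pos) auto
        also have "\<dots> = 2 * p powr (3/2) * t"
        proof -
          have "p powr (5/2) = p powr (3/2) * p powr 1" by (simp only: powr_add[symmetric]) simp
          then show ?thesis using p k by (simp add: r_def t_def field_simps)
        qed
        finally show ?thesis
          using p r H by (intro mult_right_mono mult_left_mono powr_mono2) auto
      qed
      finally show "sampled_moment n (Suc i) p h \<le> (1 + r) * sampled_moment n i p h + c"
        by (simp add: c_def)
    qed (use r in auto)
    also have "real k * c * exp (real k * r)
        = exp p * p * (2 * p powr (3/2)) powr (p / 2) * (t powr (p / 2) * H) + exp p * K * (t * D)"
    proof -
      have kr: "real k * r = p" using k by (simp add: r_def)
      have kD: "real k * (K * (D / real n)) = K * (t * D)" by (simp add: t_def)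
      have T: "(2 * p powr (3/2) * t) powr (p / 2) = (2 * p powr (3/2)) powr (p / 2) * t powr (p / 2)"
        by (rule powr_mult)
      have "real k * c = (real k * r) * ((2 * p powr (3/2)) powr (p / 2) * t powr (p / 2) * H) + K * (t * D)"
        unfolding c_def T kD[symmetric] by (simp add: distrib_left mult.assoc)
      then show ?thesis unfolding kr by algebra
    qed
    also have "\<dots> \<le> M powr p * (t powr (p / 2) * H) + M powr p * (t * D)"
      unfolding M_def K_def using diffuse_const_le[OF p] jump_const_le[OF p] t D H
      by (intro add_mono mult_right_mono) auto
    finally show ?thesis
      unfolding M_def H_def D_def t_def by (simp add: algebra_simps)
  next
    case False
    have "2 \<le> M"
    proof -
      have "1 * 1 \<le> exp 2 * (p / ln p)"
        using p lnp ln_le_self[of p] by (intro mult_mono) auto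
      then show ?thesis by (simp add: M_def)
    qed
    then have "2 \<le> M\<^sup>2" using power_mono[of 2 M 2] by simp
    then have "2 * t \<le> M\<^sup>2 * t" using t by (intro mult_right_mono) auto
    moreover have "1 \<le> 2 * t" using False k by (simp add: t_def field_simps)
    ultimately have "1 \<le> M\<^sup>2 * t" by (rule order_trans[rotated])
    then have "1 \<le> (M\<^sup>2 * t) powr (p / 2)" using p by (simp add: ge_one_powr_ge_zero)
    also have "\<dots> = M powr p * t powr (p / 2)"
      using t \<open>2 \<le> M\<close> by (simp add: powr_mult powr_powr flip: powr_numeral)
    finally have "1 * H \<le> M powr p * t powr (p / 2) * H"
      using H by (intro mult_right_mono)
    moreover have "sampled_moment n k p h \<le> H"
      unfolding H_def using p k by (intro sampled_moment_le_moment) auto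
    moreover have "0 \<le> M powr p * (t * D)" using t D by simp
    ultimately show ?thesis
      unfolding M_def[symmetric] H_def[symmetric] D_def[symmetric] t_def[symmetric]
      by (simp add: algebra_simps)
  qed
qed

lemma admissible_upper:
  assumes p: "2 \<le> p"
  shows "admissible TYPE('a::{real_normed_field, real_inner}) d p (ennreal (8 * exp 2 * (p / ln p)))"
  unfolding admissible_def
proof (intro allI ballI impI)
  fix n k and h :: "(nat \<Rightarrow> real) \<Rightarrow> 'a"
  assume k: "k \<in> {1..n}" and h: "walsh_poly n d h \<and> expec n h = 0"
  let ?M = "8 * exp 2 * (p / ln p)"
  let ?I = "real k / real n * (\<Sum>j=1..n. expec n (\<lambda>\<epsilon>. norm (flip_diff j h \<epsilon>) powr p))
      + (real k / real n) powr (p / 2) * expec n (\<lambda>\<epsilon>. norm (h \<epsilon>) powr p)"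
  have M: "0 \<le> ?M" using p by simp
  have I: "0 \<le> ?I"
    by (intro add_nonneg_nonneg mult_nonneg_nonneg sum_nonneg avg_nonneg) auto
  have "sampled_norm n k p h = sampled_moment n k p h powr (1 / p)"
    using p by (intro sampled_norm_eq) simp
  also have "\<dots> \<le> (?M powr p * ?I) powr (1 / p)"
  proof (intro powr_mono2)
    show "0 \<le> sampled_moment n k p h"
      unfolding sampled_moment_def by (intro avg_nonneg) auto
    show "sampled_moment n k p h \<le> ?M powr p * ?I"
      using p k h by (intro sampled_moment_le) auto
  qed (use p in auto)
  also have "\<dots> = ?M * ?I powr (1 / p)"
    using p M I by (simp add: powr_mult powr_powr)
  also have "?I powr (1 / p) = influence_bound n k p h"
    using p by (simp add: influence_bound_def Lnorm_powr)
  finally show "ennreal (sampled_norm n k p h) \<le> ennreal ?M * ennreal (influence_bound n k p h)"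
    using M by (simp add: ennreal_leI flip: ennreal_mult')
qed

section \<open>Sums of few signs and the lower bound\<close>

definition rademacher_sum :: "nat \<Rightarrow> (nat \<Rightarrow> real) \<Rightarrow> real" where
  "rademacher_sum q \<epsilon> = (\<Sum>j=1..q. \<epsilon> j)"

lemma expec_coord_walsh:
  assumes j: "j \<in> {1..n}" and A: "A \<subseteq> {1..n}" "A \<noteq> {j}"
  shows "expec n (\<lambda>\<epsilon>. \<epsilon> j * walsh A \<epsilon>) = 0"
proof -
  have fin: "finite A" using A finite_subset by blast
  have odd: "expec n F = 0" if "i \<in> {1..n}" "\<And>\<epsilon>. F (\<epsilon>(i := - \<epsilon> i)) = - F \<epsilon>" for i and F :: "(nat \<Rightarrow> real) \<Rightarrow> real"
    using expec_flip[of i n F] that by (simp add: avg_def sum_negf)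
  show ?thesis
  proof (cases "A = {}")
    case True
    then show ?thesis using j by (intro odd[of j]) (auto simp: walsh_def)
  next
    case False
    with A obtain i where i: "i \<in> A" "i \<noteq> j" by blast
    have "walsh A (\<epsilon>(i := - \<epsilon> i)) = - walsh A \<epsilon>" for \<epsilon>
    proof -
      have "(\<Prod>l\<in>A - {i}. (\<epsilon>(i := - \<epsilon> i)) l) = (\<Prod>l\<in>A - {i}. \<epsilon> l)"
        by (intro prod.cong) auto
      then show ?thesis
        using i fin by (simp add: walsh_def prod.remove[of A i])
    qed
    then show ?thesis using i A by (intro odd[of i]) auto
  qed
qed

lemma walsh_poly_rademacher_sum:
  assumes "1 \<le> d" "q \<le> n"
  shows "walsh_poly n d (rademacher_sum q)"
  unfolding walsh_poly_def
proof (intro allI impI)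
  fix A assume A: "A \<subseteq> {1..n}" "d < enat (card A)"
  have "A \<noteq> {j}" for j using A assms by (auto simp: one_enat_def)
  then have "expec n (\<lambda>\<epsilon>. \<epsilon> j * walsh A \<epsilon>) = 0" if "j \<in> {1..q}" for j
    using that A assms by (intro expec_coord_walsh) auto
  then show "expec n (\<lambda>\<epsilon>. rademacher_sum q \<epsilon> * of_real (walsh A \<epsilon>)) = 0"
    by (simp add: rademacher_sum_def sum_distrib_right avg_sum)
qed

lemma expec_rademacher_sum:
  assumes "q \<le> n"
  shows "expec n (rademacher_sum q) = 0"
proof -
  have "expec n (\<lambda>\<epsilon>. \<epsilon> j * walsh {} \<epsilon>) = 0" if "j \<in> {1..q}" for j
    using that assms by (intro expec_coord_walsh) auto
  then show ?thesis
    by (simp add: walsh_def avg_sum rademacher_sum_def[abs_def])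
qed

lemma flip_diff_rademacher_sum:
  "flip_diff j (rademacher_sum q) \<epsilon> = (if j \<in> {1..q} then 2 * \<epsilon> j else 0)"
proof (cases "j \<in> {1..q}")
  case True
  have "(\<Sum>l\<in>{1..q} - {j}. (\<epsilon>(j := - \<epsilon> j)) l) = (\<Sum>l\<in>{1..q} - {j}. \<epsilon> l)"
    by (intro sum.cong) auto
  then show ?thesis
    using True unfolding flip_diff_def rademacher_sum_def
    by (simp add: sum.remove[of "{1..q}" j] del: One_nat_def)
next
  case False
  then have "(\<Sum>l\<in>{1..q}. (\<epsilon>(j := - \<epsilon> j)) l) = (\<Sum>l\<in>{1..q}. \<epsilon> l)"
    by (intro sum.cong) auto
  then show ?thesis using False unfolding flip_diff_def rademacher_sum_def by auto
qed

lemma card_cube_cylinder: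
  assumes \<epsilon>: "\<epsilon> \<in> cube n" and T: "T \<subseteq> {1..n}"
  shows "real (card (cube n)) = 2 ^ card T * real (card (cylinder n T \<epsilon>))"
proof -
  have "finite T" using T finite_subset by blast
  then show ?thesis using T
  proof (induction T)
    case empty
    then show ?case by (simp add: cylinder_empty)
  next
    case (insert j T)
    then show ?case using card_cylinder_insert[OF \<epsilon>, of j T] by simp
  qed
qed

text \<open>With probability \<open>1 / 2 ^ q\<close> all signs are positive; in the regime of interest this atypical
  event carries enough of the moment.\<close>

lemma moment_rademacher_sum_ge:
  assumes "q \<le> n" and p: "0 < p"
  shows "real q powr p / 2 ^ q \<le> expec n (\<lambda>\<epsilon>. norm (rademacher_sum q \<epsilon>) powr p)"
proof -
  define \<epsilon> where "\<epsilon> = restrict (\<lambda>_. 1 :: real) {1..n}"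
  let ?C = "cylinder n {1..q} \<epsilon>"
  have \<epsilon>: "\<epsilon> \<in> cube n" by (auto simp: \<epsilon>_def cube_def)
  have card: "real (card (cube n)) = 2 ^ q * real (card ?C)"
    using card_cube_cylinder[OF \<epsilon>, of "{1..q}"] assms by simp
  have pos: "0 < real (card ?C)" using card_cylinder_pos[OF \<epsilon>] by simp
  have "rademacher_sum q \<eta> = real q" if "\<eta> \<in> ?C" for \<eta>
  proof -
    have "(\<Sum>j=1..q. \<eta> j) = (\<Sum>j=1..q. 1)"
      using that assms by (intro sum.cong) (auto simp: cylinder_def \<epsilon>_def)
    then show ?thesis by (simp add: rademacher_sum_def)
  qed
  then have "real (card ?C) * real q powr p = (\<Sum>\<eta>\<in>?C. norm (rademacher_sum q \<eta>) powr p)"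
    by simp
  also have "\<dots> \<le> (\<Sum>\<eta>\<in>cube n. norm (rademacher_sum q \<eta>) powr p)"
    using cylinder_subset_cube finite_cube by (intro sum_mono2) auto
  finally show ?thesis
    using pos by (simp add: avg_def card field_simps)
qed

text \<open>Among all sets of size \<open>q\<close> only \<open>{1..q}\<close> itself is kept, on which the sum is fully revealed.
  Both its probability, at least \<open>(q ^ 3) powr - q\<close>, and that of all signs agreeing become
  harmless after taking \<open>p\<close>-th roots once \<open>q\<close> is of order \<open>p / ln p\<close>.\<close>

lemma sampled_norm_rademacher_sum_ge:
  assumes q: "1 \<le> q" and p: "0 < p"
  shows "real q * (2 * real q ^ 3) powr (- real q / p) \<le> sampled_norm (q ^ 3) q p (rademacher_sum q)"
proof -
  let ?n = "q ^ 3" and ?h = "rademacher_sum q"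
  have qn: "q \<le> ?n" using q self_le_power[of q 3] by simp
  let ?E = "\<lambda>S. expec ?n (\<lambda>\<epsilon>. norm (proj ?n S ?h \<epsilon>) powr p)"
  have q_mem: "{1..q} \<in> subsets_of_size ?n q" using qn by (auto simp: subsets_of_size_def)
  have "real q powr p / 2 ^ q \<le> expec ?n (\<lambda>\<epsilon>. norm (?h \<epsilon>) powr p)"
    using qn p by (rule moment_rademacher_sum_ge)
  also have "\<dots> = ?E {1..q}"
  proof (intro avg_cong)
    fix \<epsilon> assume \<epsilon>: "\<epsilon> \<in> cube ?n"
    have "?h \<eta> = ?h \<epsilon>" if "\<eta> \<in> cylinder ?n {1..q} \<epsilon>" for \<eta>
      using that by (simp add: rademacher_sum_def cylinder_def)
    then have "proj ?n {1..q} ?h \<epsilon> = avg (cylinder ?n {1..q} \<epsilon>) (\<lambda>_. ?h \<epsilon>)"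
      unfolding proj_eq by (intro avg_cong)
    then have "proj ?n {1..q} ?h \<epsilon> = ?h \<epsilon>"
      using card_cylinder_pos[OF \<epsilon>, of "{1..q}"] by (simp add: avg_def)
    then show "norm (?h \<epsilon>) powr p = norm (proj ?n {1..q} ?h \<epsilon>) powr p" by simp
  qed
  also have "\<dots> \<le> (\<Sum>S\<in>subsets_of_size ?n q. ?E S)"
    using q_mem finite_subsets_of_size by (intro member_le_sum avg_nonneg) auto
  also have "\<dots> = real (?n choose q) * sampled_moment ?n q p ?h"
    using qn by (rule sum_sampled_moment)
  also have "\<dots> \<le> (real q ^ 3) ^ q * sampled_moment ?n q p ?h"
  proof (intro mult_right_mono)
    show "real (?n choose q) \<le> (real q ^ 3) ^ q"
      using binomial_le_pow[OF qn] by (metis of_nat_le_iff of_nat_power)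
    show "0 \<le> sampled_moment ?n q p ?h"
      unfolding sampled_moment_def by (intro avg_nonneg) auto
  qed
  finally have "real q powr p / (2 * real q ^ 3) ^ q \<le> sampled_moment ?n q p ?h"
    using q by (simp add: power_mult_distrib field_simps)
  then have "(real q powr p / (2 * real q ^ 3) ^ q) powr (1 / p) \<le> sampled_moment ?n q p ?h powr (1 / p)"
    using p by (intro powr_mono2) auto
  moreover have "(real q powr p / (2 * real q ^ 3) ^ q) powr (1 / p) = real q * (2 * real q ^ 3) powr (- real q / p)"
  proof -
    define B where "B = 2 * real q ^ 3"
    have B: "0 < B" using q by (simp add: B_def)
    have "(real q powr p / B ^ q) powr (1 / p) = (real q powr p / B powr real q) powr (1 / p)"
      using B by (simp add: powr_realpow)
    also have "\<dots> = (real q powr p) powr (1 / p) / (B powr real q) powr (1 / p)"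
      by (rule powr_divide)
    also have "\<dots> = real q / B powr (real q / p)"
      using p by (simp add: powr_powr)
    also have "\<dots> = real q * B powr (- real q / p)"
      by (simp add: powr_minus_divide)
    finally show ?thesis unfolding B_def .
  qed
  ultimately show ?thesis using p by (simp add: sampled_norm_eq)
qed

text \<open>The dimension is taken as \<open>q ^ 3\<close> so that \<open>k / n = 1 / q\<^sup>2\<close>: then \<open>sqrt (k / n)\<close> compensates
  even the trivial bound \<open>q\<close> for the sum, and few of its variables are expected to be
  sampled, so both terms stay bounded.\<close>

lemma influence_bound_rademacher_sum_le:
  assumes q: "1 \<le> q" and p: "2 \<le> p"
  shows "influence_bound (q ^ 3) q p (rademacher_sum q) \<le> 4"
proof -
  let ?n = "q ^ 3" and ?h = "rademacher_sum q"
  let ?I = "real q / real ?n * (\<Sum>j=1..?n. expec ?n (\<lambda>\<epsilon>. norm (flip_diff j ?h \<epsilon>) powr p))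
      + (real q / real ?n) powr (p / 2) * expec ?n (\<lambda>\<epsilon>. norm (?h \<epsilon>) powr p)"
  have qn: "q \<le> ?n" using q self_le_power[of q 3] by simp
  have coord: "\<bar>\<epsilon> j\<bar> = 1" if "\<epsilon> \<in> cube ?n" "j \<in> {1..q}" for \<epsilon> j
    using cube_coord[of \<epsilon> ?n j] that qn by auto
  have card: "0 < real (card (cube ?n))"
    using card_cylinder_pos[of "restrict (\<lambda>_. 1) {1..?n}" ?n "{}"] by (auto simp: cylinder_empty cube_def)
  have const: "expec ?n (\<lambda>_. c) = c" for c :: real
    using card by (simp add: avg_def)
  have D: "expec ?n (\<lambda>\<epsilon>. norm (flip_diff j ?h \<epsilon>) powr p) = (if j \<in> {1..q} then 2 powr p else 0)" for j
  proof -
    have "expec ?n (\<lambda>\<epsilon>. norm (flip_diff j ?h \<epsilon>) powr p) = expec ?n (\<lambda>_. if j \<in> {1..q} then 2 powr p else 0)"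
      using coord by (intro avg_cong) (auto simp: flip_diff_rademacher_sum abs_mult)
    then show ?thesis by (simp only: const)
  qed
  have "(\<Sum>j=1..?n. expec ?n (\<lambda>\<epsilon>. norm (flip_diff j ?h \<epsilon>) powr p)) = (\<Sum>j\<in>{j \<in> {1..?n}. j \<in> {1..q}}. 2 powr p)"
    unfolding D by (rule sum.inter_filter[symmetric]) simp
  also have "{j \<in> {1..?n}. j \<in> {1..q}} = {1..q}" using qn by auto
  finally have sumD: "(\<Sum>j=1..?n. expec ?n (\<lambda>\<epsilon>. norm (flip_diff j ?h \<epsilon>) powr p)) = real q * 2 powr p"
    by simp
  have H: "expec ?n (\<lambda>\<epsilon>. norm (?h \<epsilon>) powr p) \<le> real q powr p"
  proof -
    have "norm (?h \<epsilon>) \<le> real q" if "\<epsilon> \<in> cube ?n" for \<epsilon>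
    proof -
      have "norm (?h \<epsilon>) \<le> (\<Sum>j=1..q. \<bar>\<epsilon> j\<bar>)" by (simp add: rademacher_sum_def)
      also have "\<dots> = (\<Sum>j=1..q. 1)" using coord[OF that] by (intro sum.cong) auto
      finally show ?thesis by simp
    qed
    then have "expec ?n (\<lambda>\<epsilon>. norm (?h \<epsilon>) powr p) \<le> expec ?n (\<lambda>_. real q powr p)"
      using p by (intro avg_mono powr_mono2) auto
    then show ?thesis by (simp only: const)
  qed
  have t: "real q / real ?n = real q powr (-2)"
    using q by (simp add: powr_minus power3_eq_cube power2_eq_square field_simps)
  have "real q / real ?n * (real q * 2 powr p) \<le> 2 powr p"
    using q by (simp add: power3_eq_cube field_simps)
  moreover have "(real q / real ?n) powr (p / 2) * expec ?n (\<lambda>\<epsilon>. norm (?h \<epsilon>) powr p) \<le> 1"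
  proof -
    have "(real q / real ?n) powr (p / 2) * expec ?n (\<lambda>\<epsilon>. norm (?h \<epsilon>) powr p) \<le> real q powr (- p) * real q powr p"
      unfolding t using H by (simp add: powr_powr mult_left_mono)
    also have "\<dots> = 1" using q by (simp flip: powr_add)
    finally show ?thesis .
  qed
  moreover have "(2::real) powr p + 1 \<le> 4 powr p"
  proof -
    have two: "2 \<le> (2::real) powr p" using powr_mono[of 1 p "2::real"] p by simp
    then have "(2::real) powr p + 1 \<le> 2 * 2 powr p" by linarith
    also have "\<dots> \<le> 2 powr p * 2 powr p" using two by (intro mult_right_mono) auto
    also have "\<dots> = 4 powr p" by (simp flip: powr_mult)
    finally show ?thesis .
  qed
  ultimately have "?I \<le> 4 powr p"
    unfolding sumD by linarith
  moreover have "0 \<le> ?I"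
    by (intro add_nonneg_nonneg mult_nonneg_nonneg sum_nonneg avg_nonneg) auto
  ultimately have "?I powr (1 / p) \<le> (4 powr p) powr (1 / p)"
    using p by (intro powr_mono2) auto
  moreover have "influence_bound ?n q p ?h = ?I powr (1 / p)"
    using p by (simp add: influence_bound_def Lnorm_powr)
  ultimately show ?thesis using p by (simp add: powr_powr)
qed

text \<open>Testing on \<open>q = nat \<lfloor>p / ln p\<rfloor>\<close> signs: since \<open>2 * q ^ 3 \<le> p ^ 7\<close> and
  \<open>q / p \<le> 1 / ln p\<close>, the loss \<open>(2 * q ^ 3) powr (q / p)\<close> is at most \<open>exp 7\<close>.\<close>

lemma admissible_lower:
  assumes p: "2 \<le> p" and d: "1 \<le> d" and K: "admissible TYPE(real) d p K"
  shows "ennreal (exp (-7) / 8 * (p / ln p)) \<le> K"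
proof -
  have lnp: "0 < ln p" using p by simp
  define q where "q = nat \<lfloor>p / ln p\<rfloor>"
  have "1 \<le> p / ln p" using p lnp ln_le_self[of p] by simp
  have q: "1 \<le> q" "real q \<le> p / ln p" "p / ln p / 2 \<le> real q"
  proof -
    define P where "P = p / ln p"
    have P: "1 \<le> P" unfolding P_def by (fact \<open>1 \<le> p / ln p\<close>)
    have fl: "real q = of_int \<lfloor>P\<rfloor>" "(1::int) \<le> \<lfloor>P\<rfloor>"
      using P by (simp_all add: q_def P_def[symmetric])
    have "(1::real) \<le> of_int \<lfloor>P\<rfloor>" using fl(2) by linarith
    with fl(1) show "1 \<le> q" "real q \<le> p / ln p" "p / ln p / 2 \<le> real q"
      using real_of_int_floor_add_one_gt[of P] of_int_floor_le[of P]
      unfolding P_def[symmetric] by linarith+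
  qed
  have q2p: "real q \<le> 2 * p"
  proof -
    have "1 / 2 \<le> ln (2::real)" using ln_2_less_1 ln2_ge_two_thirds by linarith
    also have "\<dots> \<le> ln p" using p by simp
    finally have "p / ln p \<le> p / (1 / 2)" using p by (intro divide_left_mono) auto
    then show ?thesis using q by simp
  qed
  have "(2 * real q ^ 3) powr (real q / p) \<le> exp 7"
  proof -
    have "real q ^ 3 \<le> (2 * p) ^ 3" using q2p by (intro power_mono) auto
    then have "2 * real q ^ 3 \<le> 2 ^ 4 * p ^ 3" by (simp add: power_mult_distrib)
    also have "\<dots> \<le> p ^ 4 * p ^ 3" using p by (intro mult_right_mono power_mono) auto
    also have "\<dots> = exp (7 * ln p)"
      using p exp_of_nat_mult[of 7 "ln p"] by (simp flip: power_add)
    finally have "(2 * real q ^ 3) powr (real q / p) \<le> exp (7 * ln p) powr (real q / p)"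
      using p by (intro powr_mono2) auto
    also have "\<dots> = exp (7 * (ln p * (real q / p)))" by (simp add: powr_def)
    also have "\<dots> \<le> exp 7"
    proof -
      have "ln p * (real q / p) \<le> 1" using q(2) p lnp by (simp add: pos_le_divide_eq mult.commute)
      then show ?thesis by simp
    qed
    finally show ?thesis .
  qed
  then have e7: "exp (-7) \<le> (2 * real q ^ 3) powr (- real q / p)"
    using q by (simp add: powr_minus exp_minus le_imp_inverse_le)
  have "p / ln p / 2 * exp (-7) \<le> real q * (2 * real q ^ 3) powr (- real q / p)"
    using q e7 by (intro mult_mono) auto
  also have "\<dots> \<le> sampled_norm (q ^ 3) q p (rademacher_sum q)"
    using q p by (intro sampled_norm_rademacher_sum_ge) auto
  finally have "ennreal (p / ln p / 2 * exp (-7)) \<le> ennreal (sampled_norm (q ^ 3) q p (rademacher_sum q))"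
    by (rule ennreal_leI)
  also have "\<dots> \<le> K * ennreal (influence_bound (q ^ 3) q p (rademacher_sum q))"
  proof -
    have qn: "q \<le> q ^ 3" using q self_le_power[of q 3] by simp
    show ?thesis
      using K[unfolded admissible_def, rule_format, of q "q ^ 3" "rademacher_sum q"] q qn
        walsh_poly_rademacher_sum[OF d qn] expec_rademacher_sum[OF qn] by simp
  qed
  also have "\<dots> \<le> K * ennreal 4"
    using q p by (intro mult_left_mono ennreal_leI influence_bound_rademacher_sum_le) auto
  finally have le: "ennreal (p / ln p / 2 * exp (-7)) \<le> K * ennreal 4" .
  show ?thesis
  proof (cases K)
    case (real x)
    have "ennreal (p / ln p / 2 * exp (-7)) \<le> ennreal (x * 4)"
      using le real by (simp only: ennreal_mult)
    then have "p / ln p / 2 * exp (-7) \<le> x * 4"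
      using real by (subst (asm) ennreal_le_iff) auto
    then show ?thesis using real by (simp add: ennreal_le_iff mult.commute)
  qed simp
qed

theorem corollary5p3:
  "\<exists>c C :: real. 0 < c \<and> c \<le> C \<and>
     (\<forall>(d::enat) (p::real). 1 \<le> d \<and> 2 \<le> p \<longrightarrow>
        ennreal (c * (p / ln p)) \<le> best_const d p \<and>
        best_const d p \<le> ennreal (C * (p / ln p)))"
proof (rule exI[of _ "exp (-7) / 8"], rule exI[of _ "8 * exp 2"], intro conjI allI impI)
  have "exp (-7) \<le> exp (2::real)" by simp
  moreover have "0 < exp (2::real)" by simp
  ultimately show "exp (-7) / 8 \<le> 8 * exp (2::real)" by linarith
next
  fix d :: enat and p :: real
  assume "1 \<le> d \<and> 2 \<le> p"
  then show "ennreal (exp (-7) / 8 * (p / ln p)) \<le> best_const d p"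
    unfolding best_const_def by (intro Inf_greatest) (blast intro: admissible_lower)
next
  fix d :: enat and p :: real
  assume "1 \<le> d \<and> 2 \<le> p"
  then show "best_const d p \<le> ennreal (8 * exp 2 * (p / ln p))"
    by (intro best_const_least(3) admissible_upper) auto
qed simp

end
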